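(* Consider the problem (Q) of minimizing $\tfrac12 x^THx+c^Tx+f_0(y)$ over $(x,y)\in\mathbb{R}^n\times\mathbb{R}$ subject to $x^Tx-ay-b\le 0$, where $n\ge 2$, $H=H^T\in\mathbb{R}^{n\times n}$ is not positive semidefinite, $c\in\mathbb{R}^n$, $a>0$, $b\in\mathbb{R}$, and $f_0$ is a real-valued convex function on $\{y\in\mathbb{R}: ay+b\ge 0\}$. Let $S=\{y\in\mathbb{R}:ay+b>0\}$ and let $\lambda_1\le\lambda_2\le\dots\le\lambda_n$ be the eigenvalues of $H$ counted with multiplicity. Suppose $f_0$ is three times continuously differentiable and strongly convex in $S$, and that the function $$\psi(\mu)=a\,(f_0')^{-1}\!\left(\tfrac{\mu a}{2}\right)+b$$ is log-concave in $(\max\{-\lambda_2,0\},-\lambda_1)$. Then: (i) (Q) has at most one local non-global minimizer. (ii) $(x_*,y_* )\in\mathbb{R}^n\times\mathbb{R}$ is a local non-global minimizer of (Q) if and only if $$(H+\mu^*I)x_*+c=0\quad\text{and}\quad f_0'(y_* )-\tfrac{a\mu^*}{2}=0$$ for some $\mu^*\in(\max\{-\lambda_2,0\},-\lambda_1)$ which is a root of $\phi(\mu)=\varphi(\mu)-\psi(\mu)$ with $\phi'(\mu^* )>0$, where $\varphi(\mu)=\|(H+\mu I)^{-1}c\|^2$.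
   Context: A local non-global minimizer of a constrained problem is a feasible point that is a local minimizer but not a global minimizer. $I$ is the $n\times n$ identity matrix and $\|\cdot\|$ is the Euclidean norm. $f_0'$ denotes the (strictly increasing) derivative of $f_0$ on $S$, and $(f_0')^{-1}$ is the inverse of $f_0':S\to f_0'(S)$; in particular $f_0'(y_* )$ presupposes $y_*\in S$. The hypothesis that $\psi$ is log-concave in an interval includes that $\psi$ is defined there, i.e. $\mu a/2\in f_0'(S)$ for every $\mu$ in the interval (so that $\psi>0$ there), and means that $\ln\psi$ is concave on the interval. *)

theory Defs
  imports "HOL-Analysis.Analysis"
begin

definition positive_semidefinite :: "real^'n^'n \<Rightarrow> bool" where
  "positive_semidefinite H \<longleftrightarrow> (\<forall>x. 0 \<le> x \<bullet> (H *v x))"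

text \<open>
  The values \<open>lam 1 \<le> \<dots> \<le> lam CARD('n)\<close> are the roots of the characteristic polynomial
  \<open>det (t I - H)\<close>, each repeated according to its multiplicity. Values of \<open>lam\<close> at
  other indices are irrelevant. Here \<open>mat t\<close> is the scalar matrix \<open>t I\<close>.
\<close>
definition ordered_eigenvalues :: "real^'n^'n \<Rightarrow> (nat \<Rightarrow> real) \<Rightarrow> bool" where
  "ordered_eigenvalues H lam \<longleftrightarrow>
     mono_on {1..CARD('n)} lam \<and>
     (\<forall>t. det (mat t - H) = (\<Prod>i = 1..CARD('n). t - lam i))"

text \<open>Intended for open \<open>S\<close>; there, \<open>(deriv ^^ i) f\<close> on \<open>S\<close> depends only on \<open>f\<close> on \<open>S\<close>.\<close>
definition k_times_cont_diff_on :: "nat \<Rightarrow> (real \<Rightarrow> real) \<Rightarrow> real set \<Rightarrow> bool" where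
  "k_times_cont_diff_on k f S \<longleftrightarrow>
     (\<forall>i<k. (deriv ^^ i) f differentiable_on S) \<and> continuous_on S ((deriv ^^ k) f)"

definition strongly_convex_on :: "'a::real_normed_vector set \<Rightarrow> ('a \<Rightarrow> real) \<Rightarrow> bool" where
  "strongly_convex_on S f \<longleftrightarrow>
     convex S \<and>
     (\<exists>m>0. \<forall>x\<in>S. \<forall>y\<in>S. \<forall>t\<in>{0..1}.
        f ((1 - t) *\<^sub>R x + t *\<^sub>R y)
          \<le> (1 - t) * f x + t * f y - m / 2 * t * (1 - t) * (norm (x - y))\<^sup>2)"

definition log_concave_on :: "real set \<Rightarrow> (real \<Rightarrow> real) \<Rightarrow> bool" where
  "log_concave_on I f \<longleftrightarrow> (\<forall>x\<in>I. 0 < f x) \<and> concave_on I (\<lambda>x. ln (f x))"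

definition local_minimizer :: "('a::metric_space \<Rightarrow> real) \<Rightarrow> 'a set \<Rightarrow> 'a \<Rightarrow> bool" where
  "local_minimizer q F p \<longleftrightarrow>
     p \<in> F \<and> (\<exists>\<epsilon>>0. \<forall>z\<in>F. dist z p < \<epsilon> \<longrightarrow> q p \<le> q z)"

definition global_minimizer :: "('a \<Rightarrow> real) \<Rightarrow> 'a set \<Rightarrow> 'a \<Rightarrow> bool" where
  "global_minimizer q F p \<longleftrightarrow> p \<in> F \<and> (\<forall>z\<in>F. q p \<le> q z)"

definition local_nonglobal_minimizer ::
    "('a::metric_space \<Rightarrow> real) \<Rightarrow> 'a set \<Rightarrow> 'a \<Rightarrow> bool" where
  "local_nonglobal_minimizer q F p \<longleftrightarrow>
     local_minimizer q F p \<and> \<not> global_minimizer q F p"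

definition Q_objective ::
    "real^'n^'n \<Rightarrow> real^'n \<Rightarrow> (real \<Rightarrow> real) \<Rightarrow> (real^'n) \<times> real \<Rightarrow> real" where
  "Q_objective H c f0 = (\<lambda>(x, y). 1 / 2 * (x \<bullet> (H *v x)) + c \<bullet> x + f0 y)"

definition Q_feasible :: "real \<Rightarrow> real \<Rightarrow> ((real^'n) \<times> real) set" where
  "Q_feasible a b = {(x, y). x \<bullet> x - a * y - b \<le> 0}"

definition Q_S :: "real \<Rightarrow> real \<Rightarrow> real set" where
  "Q_S a b = {y. a * y + b > 0}"

text \<open>Meaningful only where \<open>\<mu> * a / 2 \<in> deriv f0 ` Q_S a b\<close>.\<close>
definition psi :: "real \<Rightarrow> real \<Rightarrow> (real \<Rightarrow> real) \<Rightarrow> real \<Rightarrow> real" where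
  "psi a b f0 \<mu> = a * inv_into (Q_S a b) (deriv f0) (\<mu> * a / 2) + b"

definition varphi :: "real^'n^'n \<Rightarrow> real^'n \<Rightarrow> real \<Rightarrow> real" where
  "varphi H c \<mu> = (norm (matrix_inv (H + mat \<mu>) *v c))\<^sup>2"

definition phi ::
    "real^'n^'n \<Rightarrow> real^'n \<Rightarrow> real \<Rightarrow> real \<Rightarrow> (real \<Rightarrow> real) \<Rightarrow> real \<Rightarrow> real" where
  "phi H c a b f0 \<mu> = varphi H c \<mu> - psi a b f0 \<mu>"

end

theory Submission
  imports Defs
begin

text \<open>
  At a local non-global minimizer the constraint is active and the multiplier \<open>\<mu>\<close> lies strictly
  between \<open>max {- \<lambda>\<^sub>2, 0}\<close> and \<open>- \<lambda>\<^sub>1\<close>: otherwise either the Lagrangian certifies global optimality,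
  or an explicit feasible path through the point decreases the objective. On this interval the
  stationary points form a curve \<open>X \<mu>\<close> solving \<open>(H + \<mu> I) x + c = 0\<close>. The objective, lifted to the
  constraint surface, has along this curve a derivative with the sign of \<open>phi \<mu> * varphi' \<mu>\<close>.
  Since \<open>varphi\<close> is strictly log-convex and \<open>psi\<close> is log-concave, \<open>phi\<close> has at most one root with
  positive derivative. A root with \<open>phi' \<le> 0\<close> is left downhill along the curve, or along the sphere
  if \<open>varphi' < 0\<close>. Conversely, \<open>phi' > 0\<close> makes the Hessian of the objective on the constraint
  surface, a rank-one perturbation of \<open>H + \<mu> I\<close>, positive definite.
\<close>

section \<open>Spectral decomposition\<close>

text \<open>On the active surface \<open>y = (x \<bullet> x - b) / a\<close> the problem is
  unconstrained in \<open>x\<close>. At a stationary point with multiplier \<open>\<mu>\<close> the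
  lifted objective has the Hessian \<open>H + \<mu> I + \<kappa> x x^T\<close> with
  \<open>\<kappa> = 4 f0'' / a^2\<close>. On the interval \<open>H + \<mu> I\<close> has exactly one
  negative eigenvalue, so by the determinant formula for rank-one updates the Hessian is positive
  definite iff \<open>1 + \<kappa> (x \<bullet> w) < 0\<close>, where
  \<open>(H + \<mu> I) w = x\<close>. Since \<open>x \<bullet> w = - varphi' / 2\<close> and
  \<open>psi' = a^2 / (2 f0'')\<close>, this inequality is \<open>phi' > 0\<close>. One obstacle is
  the degenerate case \<open>phi' = 0\<close>: the Hessian is singular there and second-order tests
  say nothing. Log-concavity decides it, because it forces \<open>varphi > psi\<close> to the left
  of the root, which makes that side of the curve a descent path. Another obstacle is the boundary
  \<open>a y + b = 0\<close>, where no derivative of \<open>f0\<close> is available and hence no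
  multiplier; such points are handled by convexity alone.\<close>

lemma symmetric_inner_matrix_vector:
  fixes H :: "real^'n^'n"
  assumes "transpose H = H"
  shows "x \<bullet> (H *v y) = (H *v x) \<bullet> y"
proof -
  have "(H *v x) \<bullet> y = (transpose H *v x) \<bullet> y" by (simp only: assms)
  also have "\<dots> = (x v* H) \<bullet> y" by (simp only: transpose_matrix_vector)
  also have "\<dots> = x \<bullet> (H *v y)" by (simp only: dot_lmul_matrix)
  finally show ?thesis by (rule sym)
qed

lemma mat_scaleR: "mat t *v x = t *\<^sub>R (x :: real^'n)"
proof -
  have "mat t = t *\<^sub>R (mat 1 :: real^'n^'n)"
    by (simp add: mat_def vec_eq_iff)
  then show ?thesis
    by (metis matrix_vector_mul_lid scaleR_matrix_vector_assoc)
qed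

lemma linear_term_zero:
  fixes P C :: real
  assumes "\<And>t. 0 \<le> 2 * t * P + t\<^sup>2 * C"
  shows "P = 0"
proof (rule ccontr)
  assume P: "P \<noteq> 0"
  \<comment> \<open>Minimizer of \<open>2 t P + t^2 K\<close> with
    \<open>K = \<bar>C\<bar> + 1\<close>, a positive upper bound for \<open>C\<close>.\<close>
  define t where "t = - P / (\<bar>C\<bar> + 1)"
  have pos: "\<bar>C\<bar> + 1 > 0" by simp
  have "2 * t * P + t\<^sup>2 * C \<le> 2 * t * P + t\<^sup>2 * (\<bar>C\<bar> + 1)"
    by (intro add_left_mono mult_left_mono) auto
  also have "\<dots> = - P\<^sup>2 / (\<bar>C\<bar> + 1)"
    using pos by (simp add: t_def power2_eq_square divide_simps)
  also have "\<dots> < 0" using P pos by (simp add: divide_simps)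
  finally show False using assms[of t] by simp
qed

text \<open>Rayleigh's principle on the orthogonal complement of \<open>B\<close>. The complement of
  a set of eigenvectors is invariant under a symmetric matrix, so it contains the residual
  \<open>H x - r x\<close> of a minimizer \<open>x\<close>.\<close>

lemma constrained_eigenvector:
  fixes H :: "real^'n^'n" and B :: "(real^'n) set"
  assumes symm: "transpose H = H"
    and eigB: "\<And>b. b \<in> B \<Longrightarrow> \<exists>r. H *v b = r *\<^sub>R b"
    and z: "z \<noteq> 0" "\<And>b. b \<in> B \<Longrightarrow> z \<bullet> b = 0"
  shows "\<exists>x r. norm x = 1 \<and> (\<forall>b\<in>B. x \<bullet> b = 0) \<and> H *v x = r *\<^sub>R x"
proof -
  define V where "V = {x. \<forall>b\<in>B. x \<bullet> b = 0}"
  define K where "K = V \<inter> sphere 0 1"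
  have V_eq: "V = (\<Inter>b\<in>B. {x. x \<bullet> b = 0})" by (auto simp: V_def)
  have "closed V"
    unfolding V_eq by (intro closed_INT ballI closed_Collect_eq continuous_intros)
  then have "compact K" unfolding K_def by (intro closed_Int_compact compact_sphere)
  moreover have "(1 / norm z) *\<^sub>R z \<in> K"
    using z by (auto simp: K_def V_def)
  moreover have "continuous_on K (\<lambda>x. x \<bullet> (H *v x))"
    by (intro continuous_intros linear_continuous_on) auto
  ultimately obtain x where xK: "x \<in> K" and xmin: "\<And>y. y \<in> K \<Longrightarrow> x \<bullet> (H *v x) \<le> y \<bullet> (H *v y)"
    using continuous_attains_inf[of K "\<lambda>x. x \<bullet> (H *v x)"] by blast
  have nx: "norm x = 1" and xV: "x \<in> V" using xK by (auto simp: K_def)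
  define r where "r = x \<bullet> (H *v x)"
  have ray: "r * (y \<bullet> y) \<le> y \<bullet> (H *v y)" if "y \<in> V" for y
  proof (cases "y = 0")
    case False
    have "(1 / norm y) *\<^sub>R y \<in> K" using that False by (auto simp: K_def V_def)
    from xmin[OF this] have "r \<le> (y \<bullet> (H *v y)) / (norm y)\<^sup>2"
      by (simp add: r_def matrix_vector_mult_scaleR power2_eq_square)
    then show ?thesis using False
      by (simp add: pos_le_divide_eq dot_square_norm)
  qed simp
  define u where "u = H *v x - r *\<^sub>R x"
  have uV: "u \<in> V"
  proof -
    have "(H *v x) \<bullet> b = 0" if b: "b \<in> B" for b
    proof -
      obtain s where "H *v b = s *\<^sub>R b" using eigB[OF b] by blast
      then show ?thesis
        using xV b by (simp add: symmetric_inner_matrix_vector[OF symm, symmetric] V_def)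
    qed
    then show ?thesis using xV by (auto simp: u_def V_def inner_diff_left)
  qed
  \<comment> \<open>The residual is itself an admissible direction, and the first variation along it
    is \<open>2 * (u \<bullet> u)\<close>.\<close>
  have "u \<bullet> u = 0"
  proof (rule linear_term_zero)
    fix t
    have "x + t *\<^sub>R u \<in> V" using xV uV by (auto simp: V_def inner_add_left)
    from ray[OF this]
    have "r * (x \<bullet> x) + 2 * t * r * (x \<bullet> u) + t\<^sup>2 * (r * (u \<bullet> u))
      \<le> x \<bullet> (H *v x) + 2 * t * (u \<bullet> (H *v x)) + t\<^sup>2 * (u \<bullet> (H *v u))"
      using symmetric_inner_matrix_vector[OF symm, of x u]
      by (simp add: matrix_vector_right_distrib matrix_vector_mult_scaleR inner_add inner_commute
          power2_eq_square algebra_simps)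
    moreover have "r * (x \<bullet> x) = x \<bullet> (H *v x)" using nx by (simp add: r_def dot_square_norm)
    moreover have xu: "x \<bullet> u = 0"
      using nx by (simp add: u_def r_def inner_diff_right dot_square_norm)
    moreover have "u \<bullet> (H *v x) = u \<bullet> u"
      using xu by (simp add: u_def inner_diff inner_commute)
    ultimately show "0 \<le> 2 * t * (u \<bullet> u) + t\<^sup>2 * (u \<bullet> (H *v u) - r * (u \<bullet> u))"
      by (simp add: algebra_simps)
  qed
  then have "H *v x = r *\<^sub>R x" by (simp add: u_def)
  then show ?thesis using nx xV by (auto simp: V_def)
qed

lemma orthonormal_eigenvectors_exist:
  fixes H :: "real^'n^'n"
  assumes symm: "transpose H = H" and "k \<le> CARD('n)"
  shows "\<exists>B. card B = k \<and> finite B \<and> (\<forall>b\<in>B. norm b = 1 \<and> (\<exists>r. H *v b = r *\<^sub>R b)) \<and>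
           (\<forall>b\<in>B. \<forall>b'\<in>B. b \<noteq> b' \<longrightarrow> b \<bullet> b' = 0)"
  using \<open>k \<le> CARD('n)\<close>
proof (induction k)
  case 0
  then show ?case by (intro exI[of _ "{}"]) auto
next
  case (Suc k)
  then have "k \<le> CARD('n)" by simp
  from Suc.IH[OF this] obtain B where B: "card B = k" "finite B"
      "\<And>b. b \<in> B \<Longrightarrow> norm b = 1" "\<And>b. b \<in> B \<Longrightarrow> \<exists>r. H *v b = r *\<^sub>R b"
      "\<forall>b\<in>B. \<forall>b'\<in>B. b \<noteq> b' \<longrightarrow> b \<bullet> b' = 0"
    by blast
  have "dim B < DIM(real^'n)"
    using dim_le_card'[OF B(2)] B(1) Suc.prems by simp
  then obtain z where z: "z \<noteq> 0" "\<And>y. y \<in> span B \<Longrightarrow> orthogonal z y"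
    using orthogonal_to_subspace_exists by blast
  have "z \<bullet> b = 0" if "b \<in> B" for b
    using z(2)[OF span_base[OF that]] by (simp add: orthogonal_def)
  then obtain x r where x: "norm x = 1" "\<forall>b\<in>B. x \<bullet> b = 0" "H *v x = r *\<^sub>R x"
    using constrained_eigenvector[OF symm B(4) z(1)] by blast
  have "x \<notin> B" using x(1,2) by auto
  then show ?case
    using B x by (intro exI[of _ "insert x B"]) (auto simp: inner_commute)
qed

lemma spectral_theorem:
  fixes H :: "real^'n^'n"
  assumes symm: "transpose H = H"
  shows "\<exists>(e :: 'n \<Rightarrow> real^'n) d. (\<forall>i j. e i \<bullet> e j = (if i = j then 1 else 0)) \<and>
           (\<forall>i. H *v e i = d i *\<^sub>R e i)"
proof -
  obtain B where B: "card B = CARD('n)" "finite B"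
      "\<forall>b\<in>B. norm b = 1 \<and> (\<exists>r. H *v b = r *\<^sub>R b)"
      "\<forall>b\<in>B. \<forall>b'\<in>B. b \<noteq> b' \<longrightarrow> b \<bullet> b' = 0"
    using orthonormal_eigenvectors_exist[OF symm order_refl] by blast
  obtain e :: "'n \<Rightarrow> real^'n" where e: "bij_betw e UNIV B"
    using finite_same_card_bij[of "UNIV :: 'n set" B] B by auto
  have eB: "e i \<in> B" for i using e by (auto simp: bij_betw_def)
  have inj: "e i = e j \<longleftrightarrow> i = j" for i j using e by (auto simp: bij_betw_def inj_def)
  have "\<forall>i. \<exists>r. H *v e i = r *\<^sub>R e i" using B(3) eB by blast
  from choice[OF this] obtain d where "\<forall>i. H *v e i = d i *\<^sub>R e i" by blast
  moreover have "e i \<bullet> e j = (if i = j then 1 else 0)" for i j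
  proof (cases "i = j")
    case True
    have "norm (e j) = 1" using B(3) eB by blast
    then have "e j \<bullet> e j = 1" by (simp only: dot_square_norm power_one)
    then show ?thesis using True by simp
  next
    case False
    then have "e i \<noteq> e j" using inj by blast
    then have "e i \<bullet> e j = 0" using B(4) eB by blast
    then show ?thesis by (simp only: False if_False)
  qed
  ultimately show ?thesis by blast
qed

text \<open>Conjugation by the orthogonal matrix with rows \<open>e i\<close> diagonalizes
  \<open>t I - H\<close> and preserves the determinant.\<close>

lemma det_characteristic_diagonal:
  fixes H :: "real^'n^'n" and e :: "'n \<Rightarrow> real^'n"
  assumes orth: "\<And>i j. e i \<bullet> e j = (if i = j then 1 else 0)"
    and eig: "\<And>i. H *v e i = d i *\<^sub>R e i"
  shows "det (mat t - H) = (\<Prod>j\<in>UNIV. t - d j)"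
proof -
  define P :: "real^'n^'n" where "P = (\<chi> i. e i)"
  have PPt: "P ** transpose P = mat 1"
    by (simp add: vec_eq_iff matrix_matrix_mult_def transpose_def mat_def P_def
        inner_vec_def[symmetric] inner_real_def[symmetric] orth del: inner_real_def)
  have entry: "(P ** (mat t - H) ** transpose P) $ i $ j = (if i = j then t - d j else 0)" for i j
  proof -
    have "(P ** (mat t - H) ** transpose P) $ i $ j = e i \<bullet> ((mat t - H) *v e j)"
    proof -
      have "(P ** (mat t - H) ** transpose P) $ i $ j
          = (P ** ((mat t - H) ** transpose P)) $ i $ j"
        by (simp add: matrix_mul_assoc)
      also have "\<dots> = e i \<bullet> ((mat t - H) *v e j)"
        by (simp add: matrix_matrix_mult_def matrix_vector_mult_def transpose_def P_def inner_vec_def)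
      finally show ?thesis .
    qed
    then show ?thesis
      by (simp add: matrix_vector_mult_diff_rdistrib mat_scaleR eig inner_diff_right orth)
  qed
  have "det (P ** (mat t - H) ** transpose P) = (\<Prod>j\<in>UNIV. t - d j)"
    by (subst det_diagonal) (auto simp: entry)
  moreover have "det (P ** (mat t - H) ** transpose P) = det (mat t - H) * det (P ** transpose P)"
    by (simp add: det_mul)
  ultimately show ?thesis by (simp add: PPt)
qed

text \<open>Ties the prescribed list \<open>lam\<close> to concrete eigenvectors: both linear
  factorizations of the characteristic polynomial have the same multiset of roots, and equal
  multisets differ by a permutation of the indices.\<close>

lemma ordered_eigenvalues_diagonal:
  fixes H :: "real^'n^'n" and e :: "'n \<Rightarrow> real^'n"
  assumes orth: "\<And>i j. e i \<bullet> e j = (if i = j then 1 else 0)"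
    and eig: "\<And>i. H *v e i = d i *\<^sub>R e i"
    and ord: "ordered_eigenvalues H lam"
  shows "\<exists>\<sigma>. bij_betw \<sigma> {1..CARD('n)} UNIV \<and> (\<forall>i\<in>{1..CARD('n)}. lam i = d (\<sigma> i))"
proof -
  obtain \<tau> :: "nat \<Rightarrow> 'n" where \<tau>: "bij_betw \<tau> {1..CARD('n)} UNIV"
    using finite_same_card_bij[of "{1..CARD('n)}" "UNIV :: 'n set"] by auto
  let ?A = "{1..CARD('n)}"
  have "poly (\<Prod>i\<in>?A. [:- lam i, 1:]) t = poly (\<Prod>i\<in>?A. [:- d (\<tau> i), 1:]) t" for t
  proof -
    have "(\<Prod>i\<in>?A. t - lam i) = (\<Prod>j\<in>UNIV. t - d j)"
      using ord det_characteristic_diagonal[OF orth eig, of t] by (simp add: ordered_eigenvalues_def)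
    also have "\<dots> = (\<Prod>i\<in>?A. t - d (\<tau> i))"
      by (rule prod.reindex_bij_betw[OF \<tau>, symmetric])
    finally show ?thesis by (simp add: poly_prod)
  qed
  then have "(\<Prod>i\<in>?A. [:- lam i, 1:]) = (\<Prod>i\<in>?A. [:- d (\<tau> i), 1:])"
    by (simp add: poly_eq_poly_eq_iff[symmetric] fun_eq_iff)
  then have "proots (\<Prod>i\<in>?A. [:- lam i, 1:]) = proots (\<Prod>i\<in>?A. [:- d (\<tau> i), 1:])"
    by simp
  then have "image_mset lam (mset_set ?A) = image_mset (\<lambda>i. d (\<tau> i)) (mset_set ?A)"
    by (simp add: proots_prod sum_unfold_sum_mset)
  then obtain p where p: "p permutes ?A" "\<forall>x\<in>?A. lam x = d (\<tau> (p x))"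
    by (rule image_mset_eq_implies_permutes[rotated]) auto
  then have "bij_betw (\<tau> \<circ> p) ?A UNIV"
    using \<tau> permutes_imp_bij bij_betw_trans by blast
  then show ?thesis using p(2) by (intro exI[of _ "\<tau> \<circ> p"]) auto
qed

section \<open>Necessary conditions\<close>

lemma local_minimizer_eventually:
  assumes "local_minimizer f F p" "(Z \<longlongrightarrow> p) G" "\<forall>\<^sub>F t in G. Z t \<in> F"
  shows "\<forall>\<^sub>F t in G. f p \<le> f (Z t)"
proof -
  obtain \<epsilon> where \<epsilon>: "\<epsilon> > 0" "\<forall>z\<in>F. dist z p < \<epsilon> \<longrightarrow> f p \<le> f z"
    using assms(1) by (auto simp: local_minimizer_def)
  have "\<forall>\<^sub>F t in G. dist (Z t) p < \<epsilon>"
    using assms(2) \<epsilon>(1) by (rule tendstoD)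
  with assms(3) show ?thesis by eventually_elim (use \<epsilon>(2) in auto)
qed

lemma at_right_0_le_1: "\<forall>\<^sub>F t in at_right 0. 0 < t \<and> t \<le> (1 :: real)"
  by (rule eventually_at_rightI[of 0 1]) auto

lemma Q_objective_pair:
  "Q_objective H c f0 (x, y) = 1 / 2 * (x \<bullet> (H *v x)) + c \<bullet> x + f0 y"
  by (simp add: Q_objective_def)

lemma Q_feasible_iff: "(x, y) \<in> Q_feasible a b \<longleftrightarrow> x \<bullet> x \<le> a * y + b"
  by (auto simp: Q_feasible_def)

text \<open>Feasibility forces \<open>x = 0\<close> and \<open>a y + b = 0\<close>. From this apex a
  better feasible point can be approached along a curve on which the objective already decreases
  near the start.\<close>

lemma boundary_local_minimizer_is_global:
  fixes H :: "real^'n^'n"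
  assumes a: "a > 0" and conv: "convex_on {y. a * y + b \<ge> 0} f0"
    and loc: "local_minimizer (Q_objective H c f0) (Q_feasible a b) (x, y)"
    and y: "a * y + b \<le> 0"
  shows "global_minimizer (Q_objective H c f0) (Q_feasible a b) (x, y)"
proof (rule ccontr)
  have feas: "x \<bullet> x \<le> a * y + b"
    using loc by (auto simp: local_minimizer_def Q_feasible_iff)
  then have "x \<bullet> x \<le> 0" using y by simp
  then have x0: "x = 0" by (meson inner_gt_zero_iff not_le)
  have y0: "a * y + b = 0" using feas y x0 by simp
  assume "\<not> ?thesis"
  then obtain z' y' where z': "z' \<bullet> z' \<le> a * y' + b"
      "1 / 2 * (z' \<bullet> (H *v z')) + c \<bullet> z' + f0 y' < f0 y"
    using feas by (auto simp: global_minimizer_def Q_feasible_iff Q_objective_pair x0 not_le)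
  \<comment> \<open>The quadratic term and the constraint are even in \<open>x\<close>, so
    \<open>z'\<close> may be reflected to make the linear term nonpositive.\<close>
  define s :: real where "s = (if c \<bullet> z' \<le> 0 then 1 else - 1)"
  define z where "z = s *\<^sub>R z'"
  define k where "k = 1 / 2 * (z \<bullet> (H *v z))"
  have ss: "s * s = 1" by (simp add: s_def)
  then have zz: "z \<bullet> z \<le> a * y' + b" and k: "k = 1 / 2 * (z' \<bullet> (H *v z'))"
    using z'(1) by (simp_all add: z_def k_def matrix_vector_mult_scaleR mult.assoc[symmetric])
  have cz: "c \<bullet> z \<le> 0" "c \<bullet> z \<le> c \<bullet> z'" by (auto simp: z_def s_def)
  have better: "k + c \<bullet> z + f0 y' - f0 y < 0" using z'(2) k cz by simp
  have y': "a * y' + b \<ge> 0" using zz by (meson inner_ge_zero order_trans)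
  \<comment> \<open>The square root makes the quadratic term and the constraint linear in
    \<open>t\<close>. The linear term scales with \<open>sqrt t \<ge> t\<close>, which only helps
    because \<open>c \<bullet> z \<le> 0\<close>.\<close>
  define Z where "Z t = (sqrt t *\<^sub>R z, (1 - t) * y + t * y')" for t
  have "(Z \<longlongrightarrow> (sqrt 0 *\<^sub>R z, (1 - 0) * y + 0 * y')) (at_right 0)"
    unfolding Z_def by (intro tendsto_intros)
  then have lim: "(Z \<longlongrightarrow> (x, y)) (at_right 0)" by (simp add: x0)
  have "\<forall>\<^sub>F t in at_right 0. Z t \<in> Q_feasible a b"
    using at_right_0_le_1
  proof eventually_elim
    case (elim t)
    have "t * (z \<bullet> z) \<le> t * (a * y' + b)" using zz elim by (intro mult_left_mono) auto
    also have "\<dots> = t * (a * y' + b) + (1 - t) * (a * y + b)" using y0 by simp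
    also have "\<dots> = a * ((1 - t) * y + t * y') + b" by (simp add: algebra_simps)
    finally show ?case using elim by (simp add: Z_def Q_feasible_iff mult.assoc[symmetric])
  qed
  from local_minimizer_eventually[OF loc lim this] at_right_0_le_1
  have "\<forall>\<^sub>F t in at_right (0::real). False"
  proof eventually_elim
    case (elim t)
    have "f0 ((1 - t) * y + t * y') \<le> (1 - t) * f0 y + t * f0 y'"
      using convex_onD[OF conv, of t y y'] elim y0 y' by simp
    moreover have "Q_objective H c f0 (Z t) = t * k + sqrt t * (c \<bullet> z) + f0 ((1 - t) * y + t * y')"
      using elim by (simp add: Z_def Q_objective_pair k_def matrix_vector_mult_scaleR mult.assoc[symmetric])
    moreover have "Q_objective H c f0 (x, y) = f0 y" by (simp add: x0 Q_objective_pair)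
    moreover have "sqrt t * (c \<bullet> z) \<le> t * (c \<bullet> z)"
    proof (rule mult_right_mono_neg[OF _ cz(1)])
      have "sqrt t * sqrt t \<le> sqrt t * 1" using elim by (intro mult_left_mono) auto
      then show "t \<le> sqrt t" using elim by simp
    qed
    ultimately have "0 \<le> t * (k + c \<bullet> z + f0 y' - f0 y)"
      using elim by (simp add: algebra_simps)
    then show False using better elim by (simp add: zero_le_mult_iff)
  qed
  then show False by (simp add: eventually_False trivial_limit_at_right_real)
qed

section \<open>Quadratic forms in an eigenbasis\<close>

locale eigenbasis =
  fixes H :: "real^'n^'n" and e :: "'n \<Rightarrow> real^'n" and d :: "'n \<Rightarrow> real"
  assumes symm: "transpose H = H"
    and orth: "e i \<bullet> e j = (if i = j then 1 else 0)"
    and eig: "H *v e i = d i *\<^sub>R e i"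
begin

text \<open>The family has as many members as the dimension, so \<open>P\<close> is square and its
  right inverse is also a left inverse; a vector orthogonal to all \<open>e i\<close> then
  vanishes.\<close>

lemma basis_expansion: "x = (\<Sum>j\<in>UNIV. (x \<bullet> e j) *\<^sub>R e j)"
proof -
  define y where "y = x - (\<Sum>j\<in>UNIV. (x \<bullet> e j) *\<^sub>R e j)"
  define P :: "real^'n^'n" where "P = (\<chi> i. e i)"
  have "P ** transpose P = mat 1"
    by (simp add: vec_eq_iff matrix_matrix_mult_def transpose_def mat_def P_def
        inner_vec_def[symmetric] inner_real_def[symmetric] orth del: inner_real_def)
  then have PtP: "transpose P ** P = mat 1" by (simp add: matrix_left_right_inverse)
  have "y \<bullet> e i = 0" for i
    by (simp add: y_def inner_diff_left inner_sum_left orth if_distrib cong: if_cong)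
  then have "P *v y = 0"
    by (simp add: vec_eq_iff matrix_vector_mul_component P_def inner_commute)
  then have "(transpose P ** P) *v y = 0"
    by (metis matrix_vector_mul_assoc matrix_vector_mult_0_right)
  then show ?thesis by (simp add: PtP y_def)
qed

lemma basis_eqI: "(\<And>j. x \<bullet> e j = y \<bullet> e j) \<Longrightarrow> x = y"
  by (metis (mono_tags, lifting) basis_expansion sum.cong)

lemma inner_basis: "x \<bullet> y = (\<Sum>j\<in>UNIV. (x \<bullet> e j) * (y \<bullet> e j))"
proof -
  have "x \<bullet> y = (\<Sum>j\<in>UNIV. (x \<bullet> e j) *\<^sub>R e j) \<bullet> y" using basis_expansion[of x] by simp
  also have "\<dots> = (\<Sum>j\<in>UNIV. (x \<bullet> e j) * (y \<bullet> e j))"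
    by (simp add: inner_sum_left inner_commute[of "e _"])
  finally show ?thesis .
qed

lemma H_commute: "x \<bullet> (H *v y) = (H *v x) \<bullet> y"
  by (rule symmetric_inner_matrix_vector[OF symm])

lemma H_coord: "(H *v x) \<bullet> e j = d j * (x \<bullet> e j)"
  using H_commute[of x "e j"] by (simp add: eig)

lemma shifted_form:
  "u \<bullet> (H *v u) + \<mu> * (u \<bullet> u) = (\<Sum>j\<in>UNIV. (d j + \<mu>) * (u \<bullet> e j)\<^sup>2)"
proof -
  have "u \<bullet> (H *v u) = (\<Sum>j\<in>UNIV. d j * (u \<bullet> e j)\<^sup>2)"
    by (subst inner_basis) (simp add: H_coord power2_eq_square mult_ac)
  moreover have "\<mu> * (u \<bullet> u) = (\<Sum>j\<in>UNIV. \<mu> * (u \<bullet> e j)\<^sup>2)"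
    by (subst inner_basis) (simp add: sum_distrib_left power2_eq_square)
  ultimately show ?thesis by (simp add: sum.distrib distrib_right)
qed

lemma quadratic_diff:
  "1 / 2 * ((x + t) \<bullet> (H *v (x + t))) + c \<bullet> (x + t)
    = 1 / 2 * (x \<bullet> (H *v x)) + c \<bullet> x + t \<bullet> (H *v x + c) + 1 / 2 * (t \<bullet> (H *v t))"
  using H_commute[of x t]
  by (simp add: matrix_vector_right_distrib inner_add inner_commute field_simps)

lemma stationary_coord:
  assumes "H *v x + \<mu> *\<^sub>R x + c = 0"
  shows "(d j + \<mu>) * (x \<bullet> e j) = - (c \<bullet> e j)"
proof -
  have "(H *v x + \<mu> *\<^sub>R x + c) \<bullet> e j = 0" using assms by simp
  then show ?thesis by (simp add: inner_add_left H_coord algebra_simps)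
qed

text \<open>Stationarity trades the linear term for the change of the squared norm. On a sphere the
  objective therefore changes by half of the shifted form alone; all later comparisons rest on
  this.\<close>

lemma stationary_diff:
  assumes "H *v x + \<mu> *\<^sub>R x + c = 0"
  shows "1 / 2 * ((x + t) \<bullet> (H *v (x + t))) + c \<bullet> (x + t)
    = 1 / 2 * (x \<bullet> (H *v x)) + c \<bullet> x + 1 / 2 * (t \<bullet> (H *v t) + \<mu> * (t \<bullet> t))
      - \<mu> / 2 * ((x + t) \<bullet> (x + t) - x \<bullet> x)"
proof -
  have "H *v x + c = (H *v x + \<mu> *\<^sub>R x + c) - \<mu> *\<^sub>R x" by simp
  then have "H *v x + c = - \<mu> *\<^sub>R x" by (simp add: assms)
  then show ?thesis unfolding quadratic_diff[of x t c]
    by (simp add: inner_add inner_commute field_simps)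
qed

end

text \<open>\<open>p\<close> and \<open>q\<close> index the two smallest eigenvalues. They are
  distinct indices but may carry equal values, as for a double smallest eigenvalue.
  \<open>f1\<close> and \<open>f2\<close> are the derivatives of \<open>f0\<close>, and
  \<open>m\<close> is the modulus of strong convexity.\<close>

locale generalized_trust_region = eigenbasis H e d
  for H :: "real^'n^'n" and e :: "'n \<Rightarrow> real^'n" and d :: "'n \<Rightarrow> real" +
  fixes c :: "real^'n" and a b m :: real and f0 f1 f2 :: "real \<Rightarrow> real" and p q :: 'n
  assumes pq: "p \<noteq> q" and dp_neg: "d p < 0"
    and dp_least: "d p \<le> d j" and dq_least: "j \<noteq> p \<Longrightarrow> d q \<le> d j"
    and a_pos: "a > 0" and m_pos: "m > 0"
    and conv: "convex_on {y. a * y + b \<ge> 0} f0"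
    and f1: "a * y + b > 0 \<Longrightarrow> (f0 has_real_derivative f1 y) (at y)"
    and f2: "a * y + b > 0 \<Longrightarrow> (f1 has_real_derivative f2 y) (at y)"
    and strong: "a * y + b > 0 \<Longrightarrow> a * z + b > 0 \<Longrightarrow> m * (y - z)\<^sup>2 \<le> (f1 y - f1 z) * (y - z)"
begin

abbreviation "obj \<equiv> Q_objective H c f0"
abbreviation feas :: "((real^'n) \<times> real) set" where "feas \<equiv> Q_feasible a b"

lemma norm_e: "e j \<bullet> e j = 1" by (simp add: orth)

lemma form_neg: "e p \<bullet> (H *v e p) = d p" by (simp add: eig norm_e)

lemma strict_increasing:
  assumes "a * y + b > 0" "y < z" shows "f1 y < f1 z"
proof -
  have "a * z + b > 0" using assms a_pos by (smt (verit) mult_strict_left_mono)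
  then have "0 < (f1 z - f1 y) * (z - y)"
    using strong[of z y] assms m_pos by (smt (verit) mult_pos_pos zero_less_power)
  then show ?thesis using assms(2) by (simp add: zero_less_mult_iff)
qed

lemma f2_ge:
  assumes y: "a * y + b > 0" shows "m \<le> f2 y"
proof -
  have lim: "((\<lambda>h. (f1 (y + h) - f1 y) / h) \<longlongrightarrow> f2 y) (at_right 0)"
    using f2[OF y] unfolding DERIV_def filterlim_at_split by blast
  have "\<forall>\<^sub>F h in at_right 0. m \<le> (f1 (y + h) - f1 y) / h"
    using eventually_at_right_less[of "0::real"]
  proof eventually_elim
    case (elim h)
    have "a * (y + h) + b > 0" using y a_pos elim by (simp add: distrib_left add_pos_pos) (smt (verit) mult_pos_pos)
    from strong[OF this y] have "(m * h) * h \<le> (f1 (y + h) - f1 y) * h"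
      by (simp add: power2_eq_square)
    then have "m * h \<le> f1 (y + h) - f1 y" using elim by (rule mult_right_le_imp_le)
    then show ?case using elim by (simp add: pos_le_divide_eq)
  qed
  then show ?thesis using tendsto_lowerbound[OF lim] by (simp add: trivial_limit_at_right_real)
qed

text \<open>The point of tangency is interior, but \<open>z\<close> may lie on the boundary, where
  only convexity is at hand.\<close>

lemma tangent:
  assumes y: "a * y + b > 0" and z: "a * z + b \<ge> 0"
  shows "f0 y + f1 y * (z - y) \<le> f0 z"
proof -
  have "y \<in> interior {y. a * y + b \<ge> 0}"
  proof (rule interiorI[of "{y. a * y + b > 0}"])
    show "open {y. a * y + b > 0}" by (intro open_Collect_less continuous_intros)
  qed (use y in auto)
  then have "f0 z - f0 y \<ge> f1 y * (z - y)"
    using z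
    by (intro convex_on_imp_above_tangent[OF conv convex_connected[OF convex_on_imp_convex[OF conv]]
        _ _ has_field_derivative_at_within[OF f1[OF y]]]) auto
  then show ?thesis by simp
qed

text \<open>Lagrangian certificate: \<open>H + \<mu> I\<close> is positive semidefinite,
  \<open>\<mu> \<ge> 0\<close> gives the slack of the constraint the right sign, and the tangent
  inequality handles \<open>f0\<close>.\<close>

lemma stationary_global:
  assumes y: "a * y + b > 0" and act: "x \<bullet> x = a * y + b"
    and kkt: "H *v x + \<mu> *\<^sub>R x + c = 0" "f1 y = a * \<mu> / 2"
    and mu: "\<mu> \<ge> 0" "\<mu> \<ge> - d p"
  shows "global_minimizer obj feas (x, y)"
  unfolding global_minimizer_def
proof (intro conjI ballI)
  show "(x, y) \<in> feas" using act by (simp add: Q_feasible_iff)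
  fix w assume "w \<in> feas"
  then obtain z y' where w: "w = (z, y')" and fe: "z \<bullet> z \<le> a * y' + b"
    by (cases w) (auto simp: Q_feasible_iff)
  define t where "t = z - x"
  have z: "z = x + t" by (simp add: t_def)
  have y': "a * y' + b \<ge> 0" using fe by (meson inner_ge_zero order_trans)
  have "d j + \<mu> \<ge> 0" for j using mu(2) dp_least[of j] by simp
  then have E: "t \<bullet> (H *v t) + \<mu> * (t \<bullet> t) \<ge> 0" (is "?E \<ge> 0")
    unfolding shifted_form by (intro sum_nonneg mult_nonneg_nonneg) auto
  have "\<mu> / 2 * ((x + t) \<bullet> (x + t) - x \<bullet> x) \<le> \<mu> / 2 * (a * (y' - y))"
    (is "?K \<le> _") using fe act mu by (intro mult_left_mono) (auto simp: z algebra_simps)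
  also have "\<mu> / 2 * (a * (y' - y)) = f1 y * (y' - y)" by (simp add: kkt(2))
  finally have K: "?K \<le> f1 y * (y' - y)" .
  define E K where "E = ?E" and "K = ?K"
  have "0 \<le> 1 / 2 * E - K + (f0 y' - f0 y)"
    using E K tangent[OF y y'] unfolding E_def[symmetric] K_def[symmetric] by linarith
  then show "obj (x, y) \<le> obj w"
    unfolding w z Q_objective_pair stationary_diff[OF kkt(1)] E_def K_def by simp
qed

section \<open>Descent paths and the range of the multiplier\<close>

lemma local_minimizer_active:
  assumes loc: "local_minimizer obj feas (x, y)"
  shows "x \<bullet> x = a * y + b"
proof (rule ccontr)
  assume "x \<bullet> x \<noteq> a * y + b"
  moreover have "x \<bullet> x \<le> a * y + b"
    using loc by (auto simp: local_minimizer_def Q_feasible_iff)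
  ultimately have less: "x \<bullet> x < a * y + b" by simp
  \<comment> \<open>With slack in the constraint, \<open>x\<close> can move along \<open>e p\<close>
    in either direction with \<open>y\<close> fixed; this sign makes the first-order term
    nonpositive, and the curvature \<open>d p < 0\<close> does the rest.\<close>
  define s :: real where "s = (if e p \<bullet> (H *v x + c) \<le> 0 then 1 else - 1)"
  define Z where "Z t = (x + (s * t) *\<^sub>R e p, y)" for t
  have lim1: "((\<lambda>t. x + (s * t) *\<^sub>R e p) \<longlongrightarrow> x + (s * 0) *\<^sub>R e p) (at_right 0)"
    by (intro tendsto_intros)
  then have lim: "(Z \<longlongrightarrow> (x, y)) (at_right 0)"
    unfolding Z_def by (auto intro!: tendsto_Pair)
  have "((\<lambda>t. (x + (s * t) *\<^sub>R e p) \<bullet> (x + (s * t) *\<^sub>R e p)) \<longlongrightarrow> x \<bullet> x) (at_right 0)"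
    using tendsto_inner[OF lim1 lim1] by simp
  from order_tendstoD(2)[OF this less]
  have "\<forall>\<^sub>F t in at_right 0. Z t \<in> feas"
    by eventually_elim (auto simp: Z_def Q_feasible_iff)
  from local_minimizer_eventually[OF loc lim this] at_right_0_le_1
  have "\<forall>\<^sub>F t in at_right (0::real). False"
  proof eventually_elim
    case (elim t)
    have s: "s * (e p \<bullet> (H *v x + c)) \<le> 0" "s * s = 1" by (auto simp: s_def)
    have "obj (Z t) - obj (x, y) = t * (s * (e p \<bullet> (H *v x + c))) + 1 / 2 * (t * t) * (s * s) * d p"
      unfolding Z_def Q_objective_pair quadratic_diff
      by (simp add: matrix_vector_mult_scaleR form_neg)
    also have "\<dots> < 0"
    proof (rule add_nonpos_neg)
      show "t * (s * (e p \<bullet> (H *v x + c))) \<le> 0" using s(1) elim by (simp add: mult_nonneg_nonpos)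
      show "1 / 2 * (t * t) * (s * s) * d p < 0" using elim dp_neg s(2) by (simp add: mult_pos_neg)
    qed
    finally show False using elim by simp
  qed
  then show False by (simp add: eventually_False trivial_limit_at_right_real)
qed

lemma surface_tendsto:
  assumes "x \<bullet> x = a * y + b" "(X \<longlongrightarrow> x) G"
  shows "((\<lambda>t. (X t, (X t \<bullet> X t - b) / a)) \<longlongrightarrow> (x, y)) G"
proof -
  have "((\<lambda>t. (X t, (X t \<bullet> X t - b) / a)) \<longlongrightarrow> (x, (x \<bullet> x - b) / a)) G"
    using a_pos by (intro tendsto_intros assms) auto
  then show ?thesis using assms(1) a_pos by simp
qed

lemma surface_feasible: "(z, (z \<bullet> z - b) / a) \<in> feas"
  using a_pos by (simp add: Q_feasible_iff)

text \<open>Every curve in \<open>x\<close> lifts to the constraint surface, so testing minimality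
  along it needs no separate feasibility check.\<close>

lemma surface_local_minimizer:
  assumes loc: "local_minimizer obj feas (x, y)" and act: "x \<bullet> x = a * y + b"
    and X: "(X \<longlongrightarrow> x) G"
  shows "\<forall>\<^sub>F t in G. obj (x, y) \<le> obj (X t, (X t \<bullet> X t - b) / a)"
  by (rule local_minimizer_eventually[OF loc surface_tendsto[OF act X]])
     (simp add: surface_feasible)

lemma local_minimizer_stationary:
  assumes loc: "local_minimizer obj feas (x, y)" and y: "a * y + b > 0"
  shows "H *v x + (2 * f1 y / a) *\<^sub>R x + c = 0"
proof -
  define \<mu> where "\<mu> = 2 * f1 y / a"
  \<comment> \<open>The gradient of the lifted objective serves as its own test direction; the
    derivative along it is \<open>u \<bullet> u\<close>.\<close>
  define u where "u = H *v x + \<mu> *\<^sub>R x + c"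
  note act = local_minimizer_active[OF loc]
  define X where "X t = x + t *\<^sub>R u" for t :: real
  define g where "g t = 1 / 2 * (x \<bullet> (H *v x)) + c \<bullet> x + t * (u \<bullet> (H *v x + c))
      + 1 / 2 * (t * t) * (u \<bullet> (H *v u))
      + f0 ((x \<bullet> x + 2 * t * (x \<bullet> u) + t * t * (u \<bullet> u) - b) / a)" for t
  have g: "obj (X t, (X t \<bullet> X t - b) / a) = g t" for t
    unfolding X_def Q_objective_pair quadratic_diff g_def
    by (simp add: matrix_vector_mult_scaleR inner_add inner_commute algebra_simps)
  have "(X \<longlongrightarrow> x + 0 *\<^sub>R u) (nhds 0)"
    unfolding X_def by (intro tendsto_intros filterlim_ident)
  then have X: "(X \<longlongrightarrow> x) (nhds 0)" by simp
  have "obj (x, y) = g 0" using act a_pos by (simp add: g_def Q_objective_pair)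
  then have "\<forall>\<^sub>F t in nhds 0. g 0 \<le> g t"
    using surface_local_minimizer[OF loc act X] by (simp add: g)
  then obtain \<delta> where \<delta>: "\<delta> > 0" "\<And>t. dist t 0 < \<delta> \<Longrightarrow> g 0 \<le> g t"
    by (auto simp: eventually_nhds_metric)
  have "((\<lambda>t. (x \<bullet> x + 2 * t * (x \<bullet> u) + t * t * (u \<bullet> u) - b) / a) has_real_derivative 2 * (x \<bullet> u) / a) (at 0)"
    using a_pos by (auto intro!: derivative_eq_intros)
  moreover have "(f0 has_real_derivative f1 y) (at ((x \<bullet> x + 2 * 0 * (x \<bullet> u) + 0 * 0 * (u \<bullet> u) - b) / a))"
    using f1[OF y] act a_pos by simp
  ultimately have "((\<lambda>t. f0 ((x \<bullet> x + 2 * t * (x \<bullet> u) + t * t * (u \<bullet> u) - b) / a))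
      has_real_derivative f1 y * (2 * (x \<bullet> u) / a)) (at 0)"
    using DERIV_chain2 by fast
  then have "(g has_real_derivative u \<bullet> (H *v x + c) + f1 y * (2 * (x \<bullet> u) / a)) (at 0)"
    unfolding g_def by (auto intro!: derivative_eq_intros)
  from DERIV_local_min[OF this \<delta>(1)] \<delta>(2)
  have "u \<bullet> (H *v x + c) + f1 y * (2 * (x \<bullet> u) / a) = 0" by (simp add: dist_real_def)
  moreover have "f1 y * (2 * (x \<bullet> u) / a) = \<mu> * (x \<bullet> u)" by (simp add: \<mu>_def)
  moreover have "H *v x + c = u - \<mu> *\<^sub>R x" by (simp add: u_def)
  ultimately have "u \<bullet> u = 0" by (simp add: inner_diff_right inner_commute)
  then show ?thesis by (simp add: u_def \<mu>_def)
qed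

text \<open>Raising \<open>y\<close> alone keeps the point feasible, so \<open>f0\<close> cannot be
  decreasing there.\<close>

lemma local_minimizer_multiplier_nonneg:
  assumes loc: "local_minimizer obj feas (x, y)" and y: "a * y + b > 0"
  shows "f1 y \<ge> 0"
proof (rule ccontr)
  assume "\<not> ?thesis"
  then obtain \<delta> where \<delta>: "\<delta> > 0" "\<forall>h>0. h < \<delta> \<longrightarrow> f0 (y + h) < f0 y"
    using DERIV_neg_dec_right[OF f1[OF y]] by auto
  have "((\<lambda>h. (x, y + h)) \<longlongrightarrow> (x, y + 0)) (at_right 0)" by (intro tendsto_intros)
  then have lim: "((\<lambda>h. (x, y + h)) \<longlongrightarrow> (x, y)) (at_right 0)" by simp
  have "\<forall>\<^sub>F h in at_right 0. (x, y + h) \<in> feas"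
    using eventually_at_right_less[of "0::real"]
  proof eventually_elim
    case (elim h)
    have "a * h > 0" using a_pos elim by simp
    then show ?case using local_minimizer_active[OF loc] by (simp add: Q_feasible_iff distrib_left)
  qed
  from local_minimizer_eventually[OF loc lim this]
    eventually_at_right_less[of "0::real"] eventually_at_right_real[OF \<delta>(1)]
  have "\<forall>\<^sub>F h in at_right (0::real). False"
    by eventually_elim (use \<delta>(2) in \<open>auto simp: Q_objective_pair\<close>)
  then show False by (simp add: eventually_False trivial_limit_at_right_real)
qed

abbreviation form :: "real \<Rightarrow> real^'n \<Rightarrow> real" where
  "form \<mu> u \<equiv> u \<bullet> (H *v u) + \<mu> * (u \<bullet> u)"

text \<open>\<open>deg\<close> joins the cases \<open>\<mu> = 0\<close> and \<open>x\<close>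
  orthogonal to \<open>e p\<close>. In both of them the term of order \<open>sqrt r\<close> drops
  out of the objective and the slope \<open>(d p + \<mu>) / 2 < 0\<close> remains.\<close>

lemma not_local_if_orthogonal:
  assumes y: "a * y + b > 0" and act: "x \<bullet> x = a * y + b"
    and kkt: "H *v x + \<mu> *\<^sub>R x + c = 0" "f1 y = a * \<mu> / 2"
    and mu: "\<mu> < - d p" and deg: "\<mu> * (x \<bullet> e p) = 0"
  shows "\<not> local_minimizer obj feas (x, y)"
proof
  assume loc: "local_minimizer obj feas (x, y)"
  define s :: real where "s = (if x \<bullet> e p \<le> 0 then 1 else - 1)"
  have s: "s * (x \<bullet> e p) \<le> 0" "s * s = 1" by (auto simp: s_def)
  \<comment> \<open>A step of squared length \<open>r\<close> along \<open>e p\<close> is paid for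
    by raising \<open>a * y\<close> by \<open>r\<close>; the sign \<open>s\<close> keeps the cross
    term of the constraint nonpositive.\<close>
  define Z where "Z r = (x + (s * sqrt r) *\<^sub>R e p, y + r / a)" for r
  have "(Z \<longlongrightarrow> (x + (s * sqrt 0) *\<^sub>R e p, y + 0 / a)) (at_right 0)"
    unfolding Z_def using a_pos by (intro tendsto_intros) auto
  then have lim: "(Z \<longlongrightarrow> (x, y)) (at_right 0)" by simp
  have sq: "(x + (s * sqrt r) *\<^sub>R e p) \<bullet> (x + (s * sqrt r) *\<^sub>R e p)
      = x \<bullet> x + 2 * sqrt r * (s * (x \<bullet> e p)) + r" if "r \<ge> 0" for r
    using s(2) that by (simp add: inner_add norm_e inner_commute mult_ac)
  have "\<forall>\<^sub>F r in at_right 0. Z r \<in> feas"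
    using at_right_0_le_1
  proof eventually_elim
    case (elim r)
    have "2 * sqrt r * (s * (x \<bullet> e p)) \<le> 0"
      using elim by (intro mult_nonneg_nonpos[OF _ s(1)]) auto
    then show ?case
      using elim act a_pos by (simp add: Z_def Q_feasible_iff sq distrib_left)
  qed
  note ev = local_minimizer_eventually[OF loc lim this]
  define k where "k r = 1 / 2 * r * d p + f0 (y + r / a)" for r
  have "(f0 has_real_derivative f1 y) (at (y + 0 / a))" using f1[OF y] by simp
  moreover have "((\<lambda>r. y + r / a) has_real_derivative 1 / a) (at 0)"
    using a_pos by (auto intro!: derivative_eq_intros)
  ultimately have "((\<lambda>r. f0 (y + r / a)) has_real_derivative f1 y * (1 / a)) (at 0)"
    by (rule DERIV_chain2)
  then have "(k has_real_derivative (d p + \<mu>) / 2) (at 0)"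
    unfolding k_def using a_pos by (auto intro!: derivative_eq_intros simp: kkt(2) field_simps)
  then obtain \<delta> where \<delta>: "\<delta> > 0" "\<forall>h>0. h < \<delta> \<longrightarrow> k (0 + h) < k 0"
    using DERIV_neg_dec_right[of k "(d p + \<mu>) / 2" 0] mu by auto
  from ev at_right_0_le_1 eventually_at_right_real[OF \<delta>(1)]
  have "\<forall>\<^sub>F r in at_right (0::real). False"
  proof eventually_elim
    case (elim r)
    have z: "((s * sqrt r) *\<^sub>R e p) \<bullet> (H *v ((s * sqrt r) *\<^sub>R e p)) + \<mu> * (((s * sqrt r) *\<^sub>R e p) \<bullet> ((s * sqrt r) *\<^sub>R e p))
        = r * (d p + \<mu>)"
      using elim s(2) by (simp add: matrix_vector_mult_scaleR form_neg norm_e algebra_simps)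
    have "obj (Z r) - obj (x, y) = 1 / 2 * (r * (d p + \<mu>))
        - \<mu> / 2 * (2 * sqrt r * (s * (x \<bullet> e p)) + r) + f0 (y + r / a) - f0 y"
      unfolding Z_def Q_objective_pair stationary_diff[OF kkt(1)] z using elim by (simp add: sq)
    also have "\<dots> = k r - k 0 - sqrt r * s * (\<mu> * (x \<bullet> e p))" by (simp add: k_def algebra_simps)
    also have "\<dots> = k r - k 0" by (simp add: deg)
    also have "\<dots> < 0" using \<delta>(2) elim by auto
    finally show False using elim by simp
  qed
  then show False by (simp add: eventually_False trivial_limit_at_right_real)
qed

text \<open>A point of the sphere through \<open>x\<close> is reached along the chord in direction
  \<open>u + \<epsilon> g\<close>; there the objective changes by half the value of the form on the chord.\<close>
lemma not_local_if_negative_chord: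
  assumes act: "x \<bullet> x = a * y + b"
    and kkt: "H *v x + \<mu> *\<^sub>R x + c = 0"
    and u: "x \<bullet> u = 0" "u \<noteq> 0" and g: "x \<bullet> g \<noteq> 0"
    and neg: "\<forall>\<^sub>F \<epsilon> in at_right 0. form \<mu> (u + \<epsilon> *\<^sub>R g) < 0"
  shows "\<not> local_minimizer obj feas (x, y)"
proof
  assume loc: "local_minimizer obj feas (x, y)"
  define v where "v \<epsilon> = u + \<epsilon> *\<^sub>R g" for \<epsilon>
  \<comment> \<open>The nonzero root of
    \<open>\<parallel>x + t v\<parallel>^2 = \<parallel>x\<parallel>^2\<close>. The tilt by
    \<open>g\<close> is needed because a tangent line meets the sphere only at
    \<open>x\<close>.\<close>
  define t where "t \<epsilon> = - 2 * \<epsilon> * (x \<bullet> g) / (v \<epsilon> \<bullet> v \<epsilon>)" for \<epsilon>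
  have v: "(v \<longlongrightarrow> u + 0 *\<^sub>R g) (at_right 0)" unfolding v_def by (intro tendsto_intros)
  have "(t \<longlongrightarrow> - 2 * 0 * (x \<bullet> g) / ((u + 0 *\<^sub>R g) \<bullet> (u + 0 *\<^sub>R g))) (at_right 0)"
    unfolding t_def using u(2) by (intro tendsto_intros v) auto
  then have "((\<lambda>\<epsilon>. x + t \<epsilon> *\<^sub>R v \<epsilon>) \<longlongrightarrow> x + 0 *\<^sub>R (u + 0 *\<^sub>R g)) (at_right 0)"
    by (intro tendsto_intros v) simp
  then have "((\<lambda>\<epsilon>. x + t \<epsilon> *\<^sub>R v \<epsilon>) \<longlongrightarrow> x) (at_right 0)" by simp
  from surface_local_minimizer[OF loc act this] neg at_right_0_le_1
  have "\<forall>\<^sub>F \<epsilon> in at_right (0::real). False"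
  proof eventually_elim
    case (elim \<epsilon>)
    have fneg: "form \<mu> (v \<epsilon>) < 0" using elim by (simp add: v_def)
    then have "v \<epsilon> \<noteq> 0" by auto
    then have vv: "v \<epsilon> \<bullet> v \<epsilon> > 0" by simp
    have t0: "t \<epsilon> \<noteq> 0" using vv elim g by (simp add: t_def)
    have xv: "x \<bullet> v \<epsilon> = \<epsilon> * (x \<bullet> g)" by (simp add: v_def inner_add_right u(1))
    have "t \<epsilon> * (v \<epsilon> \<bullet> v \<epsilon>) = - 2 * (x \<bullet> v \<epsilon>)" using vv by (simp add: t_def xv)
    then have "t \<epsilon> * (t \<epsilon> * (v \<epsilon> \<bullet> v \<epsilon>)) = t \<epsilon> * (- 2 * (x \<bullet> v \<epsilon>))" by simp
    then have sph: "(x + t \<epsilon> *\<^sub>R v \<epsilon>) \<bullet> (x + t \<epsilon> *\<^sub>R v \<epsilon>) = x \<bullet> x"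
      by (simp add: inner_add inner_commute)
    have "form \<mu> (t \<epsilon> *\<^sub>R v \<epsilon>) = (t \<epsilon>)\<^sup>2 * form \<mu> (v \<epsilon>)"
      by (simp add: matrix_vector_mult_scaleR power2_eq_square algebra_simps)
    then have "obj (x + t \<epsilon> *\<^sub>R v \<epsilon>, y) - obj (x, y) = 1 / 2 * ((t \<epsilon>)\<^sup>2 * form \<mu> (v \<epsilon>))"
      unfolding Q_objective_pair stationary_diff[OF kkt] sph by simp
    also have "\<dots> < 0" using fneg t0 by (simp add: mult_pos_neg)
    finally have "obj (x + t \<epsilon> *\<^sub>R v \<epsilon>, y) < obj (x, y)" by simp
    then show False using elim act a_pos by (simp add: sph)
  qed
  then show False by (simp add: eventually_False trivial_limit_at_right_real)
qed

lemma form_pq: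
  "form \<mu> (\<alpha> *\<^sub>R e p + \<beta> *\<^sub>R e q) = (d p + \<mu>) * \<alpha>\<^sup>2 + (d q + \<mu>) * \<beta>\<^sup>2"
  using pq by (simp add: matrix_vector_right_distrib matrix_vector_mult_scaleR eig inner_add orth
      power2_eq_square algebra_simps)

text \<open>The form is nonpositive on the plane of \<open>e p\<close> and \<open>e q\<close>. In
  this plane \<open>?u\<close> is tangent to the sphere at \<open>x\<close>, and \<open>?g\<close>,
  the projection of \<open>x\<close>, tilts it.\<close>

lemma not_local_if_small_multiplier:
  assumes act: "x \<bullet> x = a * y + b"
    and kkt: "H *v x + \<mu> *\<^sub>R x + c = 0"
    and mu: "\<mu> < - d p" "\<mu> \<le> - d q" and xp: "x \<bullet> e p \<noteq> 0"
  shows "\<not> local_minimizer obj feas (x, y)"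
proof (rule not_local_if_negative_chord[OF act kkt])
  let ?P = "x \<bullet> e p" and ?Q = "x \<bullet> e q"
  let ?u = "?Q *\<^sub>R e p - ?P *\<^sub>R e q" and ?g = "?P *\<^sub>R e p + ?Q *\<^sub>R e q"
  show "x \<bullet> ?u = 0" by (simp add: inner_diff_right)
  have "?u \<bullet> e q = - ?P" using pq by (simp add: inner_diff_left orth)
  then show "?u \<noteq> 0" using xp by (metis inner_zero_left neg_equal_0_iff_equal)
  have "x \<bullet> ?g = ?P\<^sup>2 + ?Q\<^sup>2" by (simp add: inner_add_right power2_eq_square)
  then show "x \<bullet> ?g \<noteq> 0" using xp by (simp add: sum_power2_eq_zero_iff)
  \<comment> \<open>Excludes the single tilt without an \<open>e p\<close> component, where the form
    would vanish if \<open>\<mu> = - d q\<close>.\<close>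
  have "\<forall>\<^sub>F \<epsilon> in at_right 0. \<epsilon> \<noteq> - ?Q / ?P" by (rule eventually_neq_at_within)
  then show "\<forall>\<^sub>F \<epsilon> in at_right 0. form \<mu> (?u + \<epsilon> *\<^sub>R ?g) < 0"
  proof eventually_elim
    case (elim \<epsilon>)
    have "?u + \<epsilon> *\<^sub>R ?g = (?Q + \<epsilon> * ?P) *\<^sub>R e p + (\<epsilon> * ?Q - ?P) *\<^sub>R e q"
      by (simp add: algebra_simps)
    then have "form \<mu> (?u + \<epsilon> *\<^sub>R ?g)
        = (d p + \<mu>) * (?Q + \<epsilon> * ?P)\<^sup>2 + (d q + \<mu>) * (\<epsilon> * ?Q - ?P)\<^sup>2"
      by (simp only: form_pq)
    also have "\<dots> < 0"
    proof (rule add_neg_nonpos)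
      have "?Q + \<epsilon> * ?P \<noteq> 0" using elim xp by (simp add: field_simps)
      then show "(d p + \<mu>) * (?Q + \<epsilon> * ?P)\<^sup>2 < 0" using mu(1) by (intro mult_neg_pos) auto
      show "(d q + \<mu>) * (\<epsilon> * ?Q - ?P)\<^sup>2 \<le> 0" using mu(2) by (intro mult_nonpos_nonneg) auto
    qed
    finally show ?case .
  qed
qed

text \<open>Orthogonality to \<open>w\<close> with respect to the form is ordinary orthogonality to
  \<open>x\<close>. The tangent space of the sphere at \<open>x\<close> is thus the form-complement
  of \<open>w\<close>.\<close>

lemma form_add:
  assumes "H *v w + \<mu> *\<^sub>R w = x"
  shows "form \<mu> (u + t *\<^sub>R w) = form \<mu> u + 2 * t * (x \<bullet> u) + t\<^sup>2 * (x \<bullet> w)"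
proof -
  have Hw: "H *v w = x - \<mu> *\<^sub>R w" using assms by (simp add: algebra_simps)
  have uHw: "u \<bullet> (H *v w) = u \<bullet> x - \<mu> * (u \<bullet> w)" and wHw: "w \<bullet> (H *v w) = w \<bullet> x - \<mu> * (w \<bullet> w)"
    by (simp_all add: Hw inner_diff_right)
  have wHu: "w \<bullet> (H *v u) = u \<bullet> x - \<mu> * (u \<bullet> w)"
    using H_commute[of w u] uHw by (simp add: inner_commute)
  have "form \<mu> (u + t *\<^sub>R w) = form \<mu> u + t * (u \<bullet> (H *v w) + w \<bullet> (H *v u) + 2 * \<mu> * (u \<bullet> w))
      + t\<^sup>2 * form \<mu> w"
    by (simp add: matrix_vector_right_distrib matrix_vector_mult_scaleR inner_add
        inner_commute[of w u] power2_eq_square algebra_simps)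
  then show ?thesis unfolding uHw wHw wHu by (simp add: inner_commute[of x])
qed

text \<open>Projecting \<open>e p\<close> along \<open>w\<close> onto the tangent space lowers the
  form by \<open>(x \<bullet> e p)^2 / (x \<bullet> w)\<close>, so a tangent direction with a
  negative value exists.\<close>

lemma not_local_if_preimage_pos:
  assumes act: "x \<bullet> x = a * y + b"
    and kkt: "H *v x + \<mu> *\<^sub>R x + c = 0" and mu: "\<mu> < - d p"
    and w: "H *v w + \<mu> *\<^sub>R w = x" "x \<bullet> w > 0"
  shows "\<not> local_minimizer obj feas (x, y)"
proof -
  define t where "t = - (x \<bullet> e p) / (x \<bullet> w)"
  define u where "u = e p + t *\<^sub>R w"
  have "form \<mu> u = d p + \<mu> + 2 * t * (x \<bullet> e p) + t\<^sup>2 * (x \<bullet> w)"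
    unfolding u_def form_add[OF w(1)] by (simp add: form_neg norm_e)
  also have "\<dots> = d p + \<mu> - (x \<bullet> e p)\<^sup>2 / (x \<bullet> w)"
    using w(2) by (simp add: t_def power2_eq_square field_simps)
  also have "\<dots> < 0" using mu w(2) by (smt (verit) divide_nonneg_pos zero_le_power2)
  finally have fu: "form \<mu> u < 0" .
  then have u0: "u \<noteq> 0" by auto
  have "x \<bullet> u = 0" using w(2) by (simp add: u_def t_def inner_add_right inner_diff_right)
  moreover have "x \<bullet> x \<noteq> 0"
  proof
    assume "x \<bullet> x = 0"
    then show False using w(2) by simp
  qed
  moreover have "\<forall>\<^sub>F \<epsilon> in at_right 0. form \<mu> (u + \<epsilon> *\<^sub>R x) < 0"
  proof (rule order_tendstoD(2)[OF _ fu])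
    have l: "((\<lambda>\<epsilon>. u + \<epsilon> *\<^sub>R x) \<longlongrightarrow> u + 0 *\<^sub>R x) (at_right 0)" by (intro tendsto_intros)
    have "((\<lambda>\<epsilon>. form \<mu> (u + \<epsilon> *\<^sub>R x)) \<longlongrightarrow> form \<mu> (u + 0 *\<^sub>R x)) (at_right 0)"
      by (intro tendsto_intros l bounded_linear.tendsto[OF matrix_vector_mul_bounded_linear])
    then show "((\<lambda>\<epsilon>. form \<mu> (u + \<epsilon> *\<^sub>R x)) \<longlongrightarrow> form \<mu> u) (at_right 0)" by simp
  qed
  ultimately show ?thesis using not_local_if_negative_chord[OF act kkt _ u0] by blast
qed

lemma local_nonglobal_multiplier:
  assumes lng: "local_nonglobal_minimizer obj feas (x, y)"
  obtains \<mu> where "a * y + b > 0" "x \<bullet> x = a * y + b" "H *v x + \<mu> *\<^sub>R x + c = 0"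
    "f1 y = a * \<mu> / 2" "max (- d q) 0 < \<mu>" "\<mu> < - d p"
proof -
  have loc: "local_minimizer obj feas (x, y)" and ng: "\<not> global_minimizer obj feas (x, y)"
    using lng by (auto simp: local_nonglobal_minimizer_def)
  have y: "a * y + b > 0"
    using boundary_local_minimizer_is_global[OF a_pos conv loc] ng by force
  define \<mu> where "\<mu> = 2 * f1 y / a"
  note act = local_minimizer_active[OF loc]
  have kkt: "H *v x + \<mu> *\<^sub>R x + c = 0" "f1 y = a * \<mu> / 2"
    using local_minimizer_stationary[OF loc y] a_pos by (auto simp: \<mu>_def)
  have mu0: "\<mu> \<ge> 0" using local_minimizer_multiplier_nonneg[OF loc y] a_pos by (simp add: \<mu>_def)
  then have mu1: "\<mu> < - d p" using stationary_global[OF y act kkt] ng by force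
  \<comment> \<open>Besides excluding \<open>\<mu> = 0\<close>, this supplies the nonzero
    \<open>e p\<close> coordinate that the chord argument for \<open>\<mu> \<le> - d q\<close>
    requires.\<close>
  have "\<mu> * (x \<bullet> e p) \<noteq> 0" using not_local_if_orthogonal[OF y act kkt mu1] loc by blast
  then have "\<mu> \<noteq> 0" "x \<bullet> e p \<noteq> 0" by auto
  moreover from this have "\<not> \<mu> \<le> - d q"
    using not_local_if_small_multiplier[OF act kkt(1) mu1] loc by blast
  ultimately show ?thesis using that[OF y act kkt _ mu1] mu0 by auto
qed

end

section \<open>The curve of stationary points\<close>

lemma has_real_derivative_shifted_power:
  assumes "k + x \<noteq> (0 :: real)"
  shows "((\<lambda>x. C / (k + x) ^ n) has_real_derivative - real n * C / (k + x) ^ Suc n) (at x)"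
proof (cases n)
  case (Suc i)
  have "((\<lambda>x. C / (k + x) ^ n) has_real_derivative
      - (C * (real n * (k + x) ^ (n - 1))) / ((k + x) ^ n * (k + x) ^ n)) (at x)"
    using assms by (auto intro!: derivative_eq_intros)
  also have "- (C * (real n * (k + x) ^ (n - 1))) / ((k + x) ^ n * (k + x) ^ n)
      = - real n * C / (k + x) ^ Suc n"
    using assms by (simp add: Suc divide_simps) (simp add: algebra_simps)
  finally show ?thesis .
qed simp

locale log_concave_trust_region = generalized_trust_region H e d c a b m f0 f1 f2 p q
  for H :: "real^'n^'n" and e :: "'n \<Rightarrow> real^'n" and d :: "'n \<Rightarrow> real"
    and c :: "real^'n" and a b m :: real and f0 f1 f2 :: "real \<Rightarrow> real" and p q :: 'n +
  assumes psi_def_on: "\<mu> \<in> {max (- d q) 0<..<- d p} \<Longrightarrow> \<mu> * a / 2 \<in> deriv f0 ` Q_S a b"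
    and psi_log_concave: "log_concave_on {max (- d q) 0<..<- d p} (psi a b f0)"
begin

abbreviation "I \<equiv> {max (- d q) 0<..<- d p}"
abbreviation "\<psi> \<equiv> psi a b f0"

lemma inj_f1: "a * y + b > 0 \<Longrightarrow> a * z + b > 0 \<Longrightarrow> f1 y = f1 z \<Longrightarrow> y = z"
  by (metis linorder_neqE_linordered_idom order_less_irrefl strict_increasing)

text \<open>Replaces \<open>inv_into\<close> by any solution \<open>y\<close> of
  \<open>f1 y = a * \<mu> / 2\<close>, which strict monotonicity makes unique.\<close>

lemma psi_eq:
  assumes y: "a * y + b > 0" and eq: "f1 y = a * \<mu> / 2"
  shows "\<psi> \<mu> = a * y + b"
proof -
  have der: "deriv f0 z = f1 z" if "z \<in> Q_S a b" for z
    using that f1 by (intro DERIV_imp_deriv) (simp add: Q_S_def)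
  have "inj_on (deriv f0) (Q_S a b)"
    by (rule inj_onI) (use inj_f1 in \<open>auto simp: der Q_S_def\<close>)
  moreover have "y \<in> Q_S a b" using y by (simp add: Q_S_def)
  moreover from this have "deriv f0 y = \<mu> * a / 2" using der eq by simp
  ultimately have "inv_into (Q_S a b) (deriv f0) (\<mu> * a / 2) = y" by (intro inv_into_f_eq)
  then show ?thesis by (simp add: psi_def)
qed

lemma psi_inverse:
  assumes "\<mu> \<in> I"
  shows "a * ((\<psi> \<mu> - b) / a) + b > 0" "f1 ((\<psi> \<mu> - b) / a) = a * \<mu> / 2"
proof -
  obtain y where y: "a * y + b > 0" "deriv f0 y = \<mu> * a / 2"
    using psi_def_on[OF assms] by (auto simp: Q_S_def)
  have "f1 y = a * \<mu> / 2" using y DERIV_imp_deriv[OF f1[OF y(1)]] by simp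
  moreover from psi_eq[OF y(1) this] have "(\<psi> \<mu> - b) / a = y" using a_pos by simp
  ultimately show "a * ((\<psi> \<mu> - b) / a) + b > 0" "f1 ((\<psi> \<mu> - b) / a) = a * \<mu> / 2"
    using y(1) by auto
qed

lemma psi_pos: "\<mu> \<in> I \<Longrightarrow> \<psi> \<mu> > 0"
  using psi_log_concave by (simp add: log_concave_on_def)

text \<open>Inverse function rule for \<open>f1\<close>. It requires continuity of the inverse at
  \<open>\<mu>\<close>, which strong monotonicity gives as a Lipschitz estimate with constant
  \<open>a / (2 * m)\<close>.\<close>

lemma psi_deriv:
  assumes mu: "\<mu> \<in> I" and y: "a * y + b > 0" "f1 y = a * \<mu> / 2"
  shows "(\<psi> has_real_derivative a\<^sup>2 / (2 * f2 y)) (at \<mu>)"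
proof -
  define g where "g \<nu> = (\<psi> \<nu> - b) / a" for \<nu>
  have gmu: "g \<mu> = y" using psi_eq[OF y] a_pos by (simp add: g_def)
  have g: "a * g \<nu> + b > 0" "f1 (g \<nu>) = a * \<nu> / 2" if "\<nu> \<in> I" for \<nu>
    using psi_inverse[OF that] by (auto simp: g_def)
  have lip: "norm (g \<nu> - y) \<le> a / (2 * m) * \<bar>\<nu> - \<mu>\<bar>" if "\<nu> \<in> I" for \<nu>
  proof (cases "g \<nu> = y")
    case False
    have eq: "f1 (g \<nu>) - f1 y = a / 2 * (\<nu> - \<mu>)"
      by (simp add: g(2)[OF that] y(2) right_diff_distrib diff_divide_distrib)
    have "m * (g \<nu> - y)\<^sup>2 \<le> a / 2 * (\<nu> - \<mu>) * (g \<nu> - y)"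
      using strong[OF g(1)[OF that] y(1)] unfolding eq .
    also have "\<dots> \<le> \<bar>a / 2 * (\<nu> - \<mu>) * (g \<nu> - y)\<bar>" by (rule abs_ge_self)
    also have "\<dots> = a / 2 * \<bar>\<nu> - \<mu>\<bar> * \<bar>g \<nu> - y\<bar>" using a_pos by (simp add: abs_mult)
    finally have "(m * \<bar>g \<nu> - y\<bar>) * \<bar>g \<nu> - y\<bar> \<le> (a / 2 * \<bar>\<nu> - \<mu>\<bar>) * \<bar>g \<nu> - y\<bar>"
      by (simp add: power2_eq_square mult.assoc)
    then have "m * \<bar>g \<nu> - y\<bar> \<le> a / 2 * \<bar>\<nu> - \<mu>\<bar>"
      by (rule mult_right_le_imp_le) (use False in simp)
    then show ?thesis using m_pos by (simp add: field_simps)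
  qed (use a_pos m_pos in simp)
  have evI: "\<forall>\<^sub>F \<nu> in at \<mu>. \<nu> \<in> I"
    using mu by (intro eventually_at_in_open') auto
  have "((\<lambda>\<nu>. a / (2 * m) * \<bar>\<nu> - \<mu>\<bar>) \<longlongrightarrow> a / (2 * m) * \<bar>\<mu> - \<mu>\<bar>) (at \<mu>)"
    by (intro tendsto_intros)
  then have "((\<lambda>\<nu>. a / (2 * m) * \<bar>\<nu> - \<mu>\<bar>) \<longlongrightarrow> 0) (at \<mu>)" by simp
  then have "((\<lambda>\<nu>. g \<nu> - y) \<longlongrightarrow> 0) (at \<mu>)"
    by (rule Lim_null_comparison[rotated]) (rule eventually_mono[OF evI lip])
  then have cont: "isCont g \<mu>" unfolding isCont_def gmu by (rule LIM_zero_cancel)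
  have "((\<lambda>y. 2 / a * f1 y) has_real_derivative 2 / a * f2 y) (at (g \<mu>))"
    unfolding gmu using f2[OF y(1)] by (rule DERIV_cmult)
  moreover have "2 / a * f2 y \<noteq> 0" using f2_ge[OF y(1)] m_pos a_pos by simp
  moreover have "2 / a * f1 (g \<nu>) = \<nu>" if "max (- d q) 0 < \<nu>" "\<nu> < - d p" for \<nu>
  proof -
    have "\<nu> \<in> I" using that by simp
    then show ?thesis using a_pos by (simp add: g(2))
  qed
  ultimately have "(g has_real_derivative inverse (2 / a * f2 y)) (at \<mu>)"
    using mu cont by (intro DERIV_inverse_function[where f="\<lambda>y. 2 / a * f1 y"
          and a="max (- d q) 0" and b="- d p"]) auto
  then have "((\<lambda>\<nu>. a * g \<nu> + b) has_real_derivative a * inverse (2 / a * f2 y)) (at \<mu>)"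
    by (auto intro!: derivative_eq_intros)
  moreover have "(\<lambda>\<nu>. a * g \<nu> + b) = \<psi>" using a_pos by (simp add: g_def fun_eq_iff)
  ultimately have "(\<psi> has_real_derivative a * inverse (2 / a * f2 y)) (at \<mu>)" by (simp only:)
  moreover have "a * inverse (2 / a * f2 y) = a\<^sup>2 / (2 * f2 y)"
    using a_pos by (simp add: power2_eq_square)
  ultimately show ?thesis by (simp only:)
qed

text \<open>\<open>V\<close> is \<open>varphi\<close> in spectral coordinates, \<open>V1\<close> and \<open>V2\<close> are its first two derivatives, and
  \<open>X \<mu>\<close> is the stationary point with multiplier \<open>\<mu>\<close>.\<close>
definition "V \<mu> = (\<Sum>j\<in>UNIV. (c \<bullet> e j)\<^sup>2 / (d j + \<mu>)\<^sup>2)"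
definition "V1 \<mu> = - 2 * (\<Sum>j\<in>UNIV. (c \<bullet> e j)\<^sup>2 / (d j + \<mu>) ^ 3)"
definition "V2 \<mu> = 6 * (\<Sum>j\<in>UNIV. (c \<bullet> e j)\<^sup>2 / (d j + \<mu>) ^ 4)"
definition "X \<mu> = - (\<Sum>j\<in>UNIV. ((c \<bullet> e j) / (d j + \<mu>)) *\<^sub>R e j)"

lemma shift_pos: "\<mu> \<in> I \<Longrightarrow> j \<noteq> p \<Longrightarrow> d j + \<mu> > 0"
  using dq_least[of j] by auto

lemma shift_neg: "\<mu> \<in> I \<Longrightarrow> d p + \<mu> < 0"
  by auto

lemma shift_nonzero: "\<mu> \<in> I \<Longrightarrow> d j + \<mu> \<noteq> 0"
  using shift_pos[of \<mu> j] shift_neg[of \<mu>] by (cases "j = p") auto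

lemma X_coord: "X \<mu> \<bullet> e j = - ((c \<bullet> e j) / (d j + \<mu>))"
  by (simp add: X_def inner_minus_left inner_sum_left orth if_distrib cong: if_cong)

lemma X_norm: "X \<mu> \<bullet> X \<mu> = V \<mu>"
  by (subst inner_basis) (simp add: X_coord V_def power2_eq_square)

lemma stationary_X:
  assumes "\<mu> \<in> I" shows "H *v x + \<mu> *\<^sub>R x + c = 0 \<longleftrightarrow> x = X \<mu>"
proof
  assume "H *v x + \<mu> *\<^sub>R x + c = 0"
  from stationary_coord[OF this] show "x = X \<mu>"
    by (intro basis_eqI) (use shift_nonzero[OF assms] in \<open>simp add: X_coord field_simps\<close>)
next
  assume x: "x = X \<mu>"
  show "H *v x + \<mu> *\<^sub>R x + c = 0"
  proof (rule basis_eqI)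
    fix j
    have "(H *v x + \<mu> *\<^sub>R x + c) \<bullet> e j = (d j + \<mu>) * (X \<mu> \<bullet> e j) + c \<bullet> e j"
      by (simp add: x inner_add_left H_coord algebra_simps)
    also have "\<dots> = 0" using shift_nonzero[OF assms, of j] by (simp add: X_coord)
    finally show "(H *v x + \<mu> *\<^sub>R x + c) \<bullet> e j = 0 \<bullet> e j" by simp
  qed
qed

lemma X_tendsto: "\<mu> \<in> I \<Longrightarrow> (X \<longlongrightarrow> X \<mu>) (at \<mu> within T)"
  unfolding X_def by (intro tendsto_intros) (use shift_nonzero in auto)

text \<open>\<open>matrix_inv\<close> is a choice that is an inverse only for invertible matrices.
  On \<open>I\<close> no shifted eigenvalue vanishes, so the kernel is trivial.\<close>

lemma varphi_eq: assumes "\<mu> \<in> I" shows "varphi H c \<mu> = V \<mu>"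
proof -
  have st: "H *v X \<mu> + \<mu> *\<^sub>R X \<mu> + c = 0" using stationary_X[OF assms] by simp
  define A where "A = H + mat \<mu>"
  have A: "A *v x = H *v x + \<mu> *\<^sub>R x" for x
    by (simp add: A_def matrix_vector_mult_add_rdistrib mat_scaleR)
  have "x = 0" if "A *v x = 0" for x
  proof (rule basis_eqI)
    fix j
    have "(A *v x) \<bullet> e j = 0" using that by simp
    then have "(d j + \<mu>) * (x \<bullet> e j) = 0" by (simp add: A inner_add_left H_coord algebra_simps)
    then show "x \<bullet> e j = 0 \<bullet> e j" using shift_nonzero[OF assms] by simp
  qed
  then obtain B where "B ** A = mat 1" using matrix_left_invertible_ker[of A] by blast
  then have "invertible A" using invertible_def matrix_left_right_inverse by blast
  then have inv: "matrix_inv A ** A = mat 1"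
    unfolding invertible_def matrix_inv_def by (rule someI_ex[THEN conjunct2])
  have "A *v X \<mu> = - c" using st by (simp add: A eq_neg_iff_add_eq_0)
  then have "c = A *v (- X \<mu>)" using linear_neg[OF matrix_vector_mul_linear, of A "X \<mu>"] by simp
  then have "matrix_inv A *v c = - X \<mu>"
    by (metis inv matrix_vector_mul_assoc matrix_vector_mul_lid)
  then show ?thesis by (simp add: varphi_def A_def[symmetric] X_norm[symmetric] dot_square_norm)
qed

section \<open>Log-convexity of \<open>V\<close> against log-concavity of \<open>psi\<close>\<close>

lemma V_deriv: "\<mu> \<in> I \<Longrightarrow> (V has_real_derivative V1 \<mu>) (at \<mu>)"
proof -
  assume mu: "\<mu> \<in> I"
  have "((\<lambda>\<mu>. \<Sum>j\<in>UNIV. (c \<bullet> e j)\<^sup>2 / (d j + \<mu>) ^ 2) has_real_derivative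
      (\<Sum>j\<in>UNIV. - real 2 * (c \<bullet> e j)\<^sup>2 / (d j + \<mu>) ^ Suc 2)) (at \<mu>)"
    by (rule DERIV_sum) (rule has_real_derivative_shifted_power[OF shift_nonzero[OF mu]])
  then show ?thesis
    unfolding V_def[abs_def] V1_def by (simp add: sum_distrib_left sum_negf eval_nat_numeral)
qed

lemma V1_deriv: "\<mu> \<in> I \<Longrightarrow> (V1 has_real_derivative V2 \<mu>) (at \<mu>)"
proof -
  assume mu: "\<mu> \<in> I"
  have "((\<lambda>\<mu>. \<Sum>j\<in>UNIV. (c \<bullet> e j)\<^sup>2 / (d j + \<mu>) ^ 3) has_real_derivative
      (\<Sum>j\<in>UNIV. - real 3 * (c \<bullet> e j)\<^sup>2 / (d j + \<mu>) ^ Suc 3)) (at \<mu>)"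
    by (rule DERIV_sum) (rule has_real_derivative_shifted_power[OF shift_nonzero[OF mu]])
  from DERIV_cmult[OF this, of "- 2"] show ?thesis
    unfolding V1_def[abs_def] V2_def
    by (simp add: sum_distrib_left sum_negf eval_nat_numeral)
qed

lemma V_pos:
  assumes "c \<noteq> 0" "\<mu> \<in> I" shows "V \<mu> > 0" "V2 \<mu> > 0"
proof -
  obtain j where j: "c \<bullet> e j \<noteq> 0" using basis_eqI[of c 0] assms(1) by auto
  show "V \<mu> > 0" unfolding V_def
    by (rule sum_pos2[of _ j]) (use j shift_nonzero[OF assms(2)] in auto)
  have "(\<Sum>j\<in>UNIV. (c \<bullet> e j)\<^sup>2 / (d j + \<mu>) ^ 4) > 0"
    by (rule sum_pos2[of _ j]) (use j shift_nonzero[OF assms(2)] in auto)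
  then show "V2 \<mu> > 0" by (simp add: V2_def)
qed

text \<open>Cauchy-Schwarz for \<open>?u\<close> and \<open>?v\<close>. The factor
  \<open>- 2\<close> of \<open>V1\<close> contributes 4 and the factor of \<open>V2\<close> is 6;
  the ratio \<open>4 / 6 < 1\<close> supplies the strictness that Cauchy-Schwarz does not
  give.\<close>

lemma V_strict_log_convex:
  assumes "c \<noteq> 0" "\<mu> \<in> I" shows "(V1 \<mu>)\<^sup>2 < V \<mu> * V2 \<mu>"
proof -
  let ?u = "\<lambda>j. (c \<bullet> e j) / (d j + \<mu>)" and ?v = "\<lambda>j. (c \<bullet> e j) / (d j + \<mu>)\<^sup>2"
  have "(\<Sum>j\<in>UNIV. ?u j * ?v j)\<^sup>2 \<le> (\<Sum>j\<in>UNIV. (?u j)\<^sup>2) * (\<Sum>j\<in>UNIV. (?v j)\<^sup>2)"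
    by (rule Cauchy_Schwarz_ineq_sum)
  moreover have "V \<mu> = (\<Sum>j\<in>UNIV. (?u j)\<^sup>2)" by (simp add: V_def power_divide)
  moreover have "V1 \<mu> = - 2 * (\<Sum>j\<in>UNIV. ?u j * ?v j)"
    by (simp add: V1_def power2_eq_square power3_eq_cube mult_ac)
  moreover have "V2 \<mu> = 6 * (\<Sum>j\<in>UNIV. (?v j)\<^sup>2)"
    by (simp add: V2_def power_divide flip: power_mult)
  ultimately have "(V1 \<mu>)\<^sup>2 \<le> 4 / 6 * (V \<mu> * V2 \<mu>)" by (simp add: power_mult_distrib)
  moreover have "V \<mu> * V2 \<mu> > 0" using V_pos[OF assms] by simp
  ultimately show ?thesis by simp
qed

lemma ln_V_above_tangent:
  assumes c0: "c \<noteq> 0" and mu: "\<mu> \<in> I" "\<nu> \<in> I" "\<nu> \<noteq> \<mu>"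
  shows "ln (V \<mu>) + V1 \<mu> / V \<mu> * (\<nu> - \<mu>) < ln (V \<nu>)"
proof -
  have d1: "((\<lambda>x. ln (V x)) has_real_derivative V1 x / V x) (at x)" if "x \<in> I" for x
    using V_deriv[OF that] V_pos(1)[OF c0 that] by (auto intro!: derivative_eq_intros)
  have d2: "((\<lambda>x. V1 x / V x) has_real_derivative (V2 x * V x - V1 x * V1 x) / (V x * V x)) (at x)"
    if "x \<in> I" for x
    using V_deriv[OF that] V1_deriv[OF that] V_pos(1)[OF c0 that] by (auto intro!: derivative_eq_intros)
  have mono: "V1 x / V x < V1 z / V z" if "x \<in> I" "z \<in> I" "x < z" for x z
  proof (rule DERIV_pos_imp_increasing[OF that(3)])
    fix t assume "x \<le> t" "t \<le> z"
    then have t: "t \<in> I" using that by auto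
    have "(V2 t * V t - V1 t * V1 t) / (V t * V t) > 0"
      using V_strict_log_convex[OF c0 t] V_pos(1)[OF c0 t]
      by (intro divide_pos_pos) (simp_all add: power2_eq_square mult.commute)
    then show "\<exists>y. ((\<lambda>x. V1 x / V x) has_real_derivative y) (at t) \<and> 0 < y"
      using d2[OF t] by blast
  qed
  show ?thesis
  proof (cases "\<mu> < \<nu>")
    case True
    have "\<And>x. \<mu> \<le> x \<Longrightarrow> x \<le> \<nu> \<Longrightarrow> ((\<lambda>x. ln (V x)) has_real_derivative V1 x / V x) (at x)"
      using mu by (intro d1) auto
    from MVT2[OF True this] obtain z where z: "\<mu> < z" "z < \<nu>"
        "ln (V \<nu>) - ln (V \<mu>) = (\<nu> - \<mu>) * (V1 z / V z)" by blast
    have "V1 \<mu> / V \<mu> < V1 z / V z" using mu z by (intro mono) auto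
    then have "(\<nu> - \<mu>) * (V1 \<mu> / V \<mu>) < (\<nu> - \<mu>) * (V1 z / V z)"
      using True by (intro mult_strict_left_mono) auto
    with z(3) show ?thesis by (simp add: mult.commute)
  next
    case False
    then have less: "\<nu> < \<mu>" using mu(3) by simp
    have "\<And>x. \<nu> \<le> x \<Longrightarrow> x \<le> \<mu> \<Longrightarrow> ((\<lambda>x. ln (V x)) has_real_derivative V1 x / V x) (at x)"
      using mu by (intro d1) auto
    from MVT2[OF less this] obtain z where z: "\<nu> < z" "z < \<mu>"
        "ln (V \<mu>) - ln (V \<nu>) = (\<mu> - \<nu>) * (V1 z / V z)" by blast
    define A B where "A = V1 \<mu> / V \<mu>" and "B = V1 z / V z"
    have "B < A" unfolding A_def B_def using mu z by (intro mono) auto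
    then have "(\<mu> - \<nu>) * B < (\<mu> - \<nu>) * A"
      using less by (intro mult_strict_left_mono) auto
    with z(3) show ?thesis
      unfolding A_def[symmetric] B_def[symmetric] by (simp add: algebra_simps)
  qed
qed

lemma ln_psi_below_tangent:
  assumes mu: "\<mu> \<in> I" "\<nu> \<in> I" and P: "(\<psi> has_real_derivative P) (at \<mu>)"
  shows "ln (\<psi> \<nu>) \<le> ln (\<psi> \<mu>) + P / \<psi> \<mu> * (\<nu> - \<mu>)"
proof -
  have cc: "convex_on I (\<lambda>x. - ln (\<psi> x))"
    using psi_log_concave by (simp add: log_concave_on_def concave_on_def)
  have der: "((\<lambda>x. - ln (\<psi> x)) has_real_derivative - (P / \<psi> \<mu>)) (at \<mu>)"
    using P psi_pos[OF mu(1)] by (auto intro!: derivative_eq_intros)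
  have "- ln (\<psi> \<nu>) - - ln (\<psi> \<mu>) \<ge> - (P / \<psi> \<mu>) * (\<nu> - \<mu>)"
    using mu by (intro convex_on_imp_above_tangent[OF cc connected_Ioo _ _
          has_field_derivative_at_within[OF der]]) (auto simp: interior_open)
  then show ?thesis by simp
qed

text \<open>At a root both logarithms have the same value, and their slopes are \<open>V1\<close>
  and \<open>P\<close> over that common value. \<open>sgn\<close> orders the two tangents on the
  side of \<open>\<nu>\<close>; \<open>ln V\<close> lies strictly above its tangent and
  \<open>ln psi\<close> below its own. Slope \<open>V1 \<mu> - P = 0\<close> is allowed, on either
  side.\<close>

lemma log_gap:
  assumes c0: "c \<noteq> 0" and mu: "\<mu> \<in> I" "\<nu> \<in> I" "\<nu> \<noteq> \<mu>" and root: "V \<mu> = \<psi> \<mu>"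
    and P: "(\<psi> has_real_derivative P) (at \<mu>)" and sgn: "0 \<le> (V1 \<mu> - P) * (\<nu> - \<mu>)"
  shows "\<psi> \<nu> < V \<nu>"
proof -
  have "0 \<le> (V1 \<mu> - P) * (\<nu> - \<mu>) / \<psi> \<mu>" using sgn psi_pos[OF mu(1)] by simp
  also have "\<dots> = V1 \<mu> / V \<mu> * (\<nu> - \<mu>) - P / \<psi> \<mu> * (\<nu> - \<mu>)"
    by (simp add: root diff_divide_distrib left_diff_distrib)
  finally have "ln (\<psi> \<nu>) < ln (V \<nu>)"
    using ln_V_above_tangent[OF c0 mu] ln_psi_below_tangent[OF mu(1,2) P] root by simp
  then show ?thesis using V_pos(1)[OF c0 mu(2)] psi_pos[OF mu(2)] by simp
qed

section \<open>The objective along the curve of stationary points\<close>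

definition "J \<nu> = obj (X \<nu>, (X \<nu> \<bullet> X \<nu> - b) / a)"

text \<open>The gradient of the quadratic part at \<open>X \<nu>\<close> is
  \<open>- \<nu> X \<nu>\<close>, so this part changes at the rate
  \<open>- \<nu> / 2 * V1 \<nu>\<close>; the chain rule through \<open>y = (V \<nu> - b) / a\<close>
  gives the other term.\<close>

lemma J_deriv:
  assumes c0: "c \<noteq> 0" and nu: "\<nu> \<in> I"
  shows "(J has_real_derivative (f1 ((V \<nu> - b) / a) / a - \<nu> / 2) * V1 \<nu>) (at \<nu>)"
proof -
  let ?C = "\<lambda>j. (c \<bullet> e j)\<^sup>2"
  define K where "K \<nu> = (\<Sum>j\<in>UNIV. d j / 2 * (?C j / (d j + \<nu>) ^ 2) - ?C j / (d j + \<nu>) ^ 1)" for \<nu>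
  have K: "1 / 2 * (X \<nu> \<bullet> (H *v X \<nu>)) + c \<bullet> X \<nu> = K \<nu>" for \<nu>
  proof -
    have "X \<nu> \<bullet> (H *v X \<nu>) = (\<Sum>j\<in>UNIV. d j * (?C j / (d j + \<nu>) ^ 2))"
      by (subst inner_basis) (simp add: X_coord H_coord power2_eq_square mult_ac)
    moreover have "c \<bullet> X \<nu> = (\<Sum>j\<in>UNIV. - (?C j / (d j + \<nu>) ^ 1))"
      by (subst inner_basis) (simp add: X_coord power2_eq_square mult_ac)
    ultimately show ?thesis
      unfolding K_def by (simp add: sum_distrib_left sum_subtractf sum_negf)
  qed
  have J: "J = (\<lambda>\<nu>. K \<nu> + f0 ((V \<nu> - b) / a))"
    by (rule ext) (simp only: J_def Q_objective_pair K X_norm)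
  have "(K has_real_derivative (\<Sum>j\<in>UNIV. d j / 2 * (- real 2 * ?C j / (d j + \<nu>) ^ Suc 2)
      - (- real 1 * ?C j / (d j + \<nu>) ^ Suc 1))) (at \<nu>)"
    unfolding K_def
    by (intro DERIV_sum DERIV_diff DERIV_cmult has_real_derivative_shifted_power shift_nonzero[OF nu])
  also have "(\<Sum>j\<in>UNIV. d j / 2 * (- real 2 * ?C j / (d j + \<nu>) ^ Suc 2)
      - (- real 1 * ?C j / (d j + \<nu>) ^ Suc 1)) = (\<Sum>j\<in>UNIV. \<nu> * (?C j / (d j + \<nu>) ^ 3))"
  proof (rule sum.cong[OF refl])
    fix j
    have cancel: "t * (C / t ^ 3) = C / t\<^sup>2" if "t \<noteq> 0" for t C :: real
      using that by (simp add: power2_eq_square power3_eq_cube)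
    have nz: "d j + \<nu> \<noteq> 0" by (rule shift_nonzero[OF nu])
    have "\<nu> * (?C j / (d j + \<nu>) ^ 3) = ((d j + \<nu>) - d j) * (?C j / (d j + \<nu>) ^ 3)" by simp
    also have "\<dots> = (d j + \<nu>) * (?C j / (d j + \<nu>) ^ 3) - d j * (?C j / (d j + \<nu>) ^ 3)"
      by (rule left_diff_distrib)
    also have "(d j + \<nu>) * (?C j / (d j + \<nu>) ^ 3) = ?C j / (d j + \<nu>)\<^sup>2"
      by (rule cancel[OF nz])
    finally show "d j / 2 * (- real 2 * ?C j / (d j + \<nu>) ^ Suc 2)
      - (- real 1 * ?C j / (d j + \<nu>) ^ Suc 1) = \<nu> * (?C j / (d j + \<nu>) ^ 3)"
      by (simp add: eval_nat_numeral)
  qed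
  also have "\<dots> = - \<nu> / 2 * V1 \<nu>" by (simp add: V1_def sum_distrib_left)
  finally have dK: "(K has_real_derivative - \<nu> / 2 * V1 \<nu>) (at \<nu>)" .
  have "(f0 has_real_derivative f1 ((V \<nu> - b) / a)) (at ((V \<nu> - b) / a))"
    using V_pos(1)[OF c0 nu] a_pos by (intro f1) simp
  moreover have "((\<lambda>\<nu>. (V \<nu> - b) / a) has_real_derivative V1 \<nu> / a) (at \<nu>)"
    using V_deriv[OF nu] a_pos by (auto intro!: derivative_eq_intros)
  ultimately have "((\<lambda>\<nu>. f0 ((V \<nu> - b) / a)) has_real_derivative
      f1 ((V \<nu> - b) / a) * (V1 \<nu> / a)) (at \<nu>)" by (rule DERIV_chain2)
  from DERIV_add[OF dK this] show ?thesis
    unfolding J by (simp add: algebra_simps)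
qed

text \<open>The factor would vanish at \<open>y = (\<psi> \<nu> - b) / a\<close>, and
  \<open>f1\<close> is strictly increasing.\<close>

lemma J_deriv_factor_sign:
  assumes "c \<noteq> 0" "\<nu> \<in> I"
  shows "\<psi> \<nu> < V \<nu> \<Longrightarrow> f1 ((V \<nu> - b) / a) / a - \<nu> / 2 > 0"
    and "V \<nu> < \<psi> \<nu> \<Longrightarrow> f1 ((V \<nu> - b) / a) / a - \<nu> / 2 < 0"
proof -
  note psi = psi_inverse[OF assms(2)]
  have V: "a * ((V \<nu> - b) / a) + b > 0" using V_pos(1)[OF assms] a_pos by simp
  show "f1 ((V \<nu> - b) / a) / a - \<nu> / 2 > 0" if "\<psi> \<nu> < V \<nu>"
  proof -
    have "f1 ((\<psi> \<nu> - b) / a) < f1 ((V \<nu> - b) / a)"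
      using that a_pos by (intro strict_increasing[OF psi(1)]) (simp add: divide_strict_right_mono)
    then show ?thesis using a_pos by (simp add: psi(2) field_simps)
  qed
  show "f1 ((V \<nu> - b) / a) / a - \<nu> / 2 < 0" if "V \<nu> < \<psi> \<nu>"
  proof -
    have "f1 ((V \<nu> - b) / a) < f1 ((\<psi> \<nu> - b) / a)"
      using that a_pos by (intro strict_increasing[OF V]) (simp add: divide_strict_right_mono)
    then show ?thesis using a_pos by (simp add: psi(2) field_simps)
  qed
qed

lemma local_minimizer_J:
  assumes loc: "local_minimizer obj feas (x, y)" and act: "x \<bullet> x = a * y + b"
    and mu: "\<mu> \<in> I" and x: "x = X \<mu>"
  shows "\<forall>\<^sub>F \<nu> in at \<mu>. J \<mu> \<le> J \<nu>"
proof -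
  have "obj (x, y) = J \<mu>" using a_pos act by (simp add: J_def x[symmetric])
  then show ?thesis
    using surface_local_minimizer[OF loc act, of X "at \<mu>"] X_tendsto[OF mu] by (simp add: J_def x)
qed

lemma root_of_stationary:
  assumes y: "a * y + b > 0" and act: "x \<bullet> x = a * y + b"
    and kkt: "H *v x + \<mu> *\<^sub>R x + c = 0" "f1 y = a * \<mu> / 2" and mu: "\<mu> \<in> I"
  shows "V \<mu> = \<psi> \<mu>" "c \<noteq> 0"
proof -
  have x: "x = X \<mu>" using stationary_X[OF mu] kkt(1) by blast
  show "V \<mu> = \<psi> \<mu>" using act psi_eq[OF y kkt(2)] by (simp add: x X_norm)
  show "c \<noteq> 0"
  proof
    assume "c = 0"
    then have "V \<mu> = 0" unfolding V_def by simp
    then show False using act y by (simp add: x X_norm)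
  qed
qed

text \<open>The derivative of the curve \<open>X\<close> at \<open>\<mu>\<close> is
  \<open>- w\<close>, which explains \<open>V1 = - 2 (x \<bullet> w)\<close>.\<close>

lemma preimage_of_stationary:
  assumes kkt: "H *v x + \<mu> *\<^sub>R x + c = 0" and mu: "\<mu> \<in> I"
  obtains w where "H *v w + \<mu> *\<^sub>R w = x" "x \<bullet> w = - V1 \<mu> / 2"
proof
  have x: "x = X \<mu>" using stationary_X[OF mu] kkt(1) by blast
  define w where "w = (\<Sum>j\<in>UNIV. ((x \<bullet> e j) / (d j + \<mu>)) *\<^sub>R e j)"
  have we: "w \<bullet> e j = (x \<bullet> e j) / (d j + \<mu>)" for j
    by (simp add: w_def inner_sum_left orth if_distrib cong: if_cong)
  show "H *v w + \<mu> *\<^sub>R w = x"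
  proof (rule basis_eqI)
    fix j
    have "(H *v w + \<mu> *\<^sub>R w) \<bullet> e j = (d j + \<mu>) * (w \<bullet> e j)"
      by (simp add: inner_add_left H_coord algebra_simps)
    then show "(H *v w + \<mu> *\<^sub>R w) \<bullet> e j = x \<bullet> e j"
      using shift_nonzero[OF mu, of j] by (simp add: we)
  qed
  show "x \<bullet> w = - V1 \<mu> / 2"
    by (subst inner_basis) (simp add: we x X_coord V1_def power2_eq_square power3_eq_cube mult_ac)
qed

lemma local_minimizer_derivative_pos:
  assumes loc: "local_minimizer obj feas (x, y)"
    and y: "a * y + b > 0" and act: "x \<bullet> x = a * y + b"
    and kkt: "H *v x + \<mu> *\<^sub>R x + c = 0" "f1 y = a * \<mu> / 2" and mu: "\<mu> \<in> I"
  shows "V1 \<mu> - a\<^sup>2 / (2 * f2 y) > 0"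
proof (rule ccontr)
  define P where "P = a\<^sup>2 / (2 * f2 y)"
  have P: "(\<psi> has_real_derivative P) (at \<mu>)" unfolding P_def by (rule psi_deriv[OF mu y kkt(2)])
  have P0: "P > 0" using f2_ge[OF y] m_pos a_pos by (simp add: P_def)
  assume "\<not> ?thesis"
  then have D: "V1 \<mu> - P \<le> 0" by (simp add: P_def)
  have x: "x = X \<mu>" using stationary_X[OF mu] kkt(1) by blast
  note root = root_of_stationary(1)[OF y act kkt mu] and c0 = root_of_stationary(2)[OF y act kkt mu]
  \<comment> \<open>Here \<open>x \<bullet> w > 0\<close>, which gives a descent on the
    sphere.\<close>
  have "\<not> V1 \<mu> < 0"
  proof
    assume neg: "V1 \<mu> < 0"
    obtain w where w: "H *v w + \<mu> *\<^sub>R w = x" "x \<bullet> w = - V1 \<mu> / 2"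
      using preimage_of_stationary[OF kkt(1) mu] .
    then show False
      using not_local_if_preimage_pos[OF act kkt(1) _ w(1)] neg mu loc by simp
  qed
  then have V10: "V1 \<mu> \<ge> 0" by simp
  obtain \<delta>1 where \<delta>1: "\<delta>1 > 0" "\<And>\<nu>. \<nu> \<noteq> \<mu> \<Longrightarrow> \<bar>\<nu> - \<mu>\<bar> < \<delta>1 \<Longrightarrow> J \<mu> \<le> J \<nu> \<and> \<nu> \<in> I"
  proof -
    have "\<forall>\<^sub>F \<nu> in at \<mu>. \<nu> \<in> I" using mu by (intro eventually_at_in_open') auto
    with local_minimizer_J[OF loc act mu x] have "\<forall>\<^sub>F \<nu> in at \<mu>. J \<mu> \<le> J \<nu> \<and> \<nu> \<in> I"
      by (rule eventually_conj)
    then show ?thesis using that by (auto simp: eventually_at dist_real_def)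
  qed
  have contJ: "continuous_on T J" if "T \<subseteq> I" for T
    using that DERIV_isCont[OF J_deriv[OF c0]] by (intro continuous_at_imp_continuous_on) blast
  show False
  proof (cases "V1 \<mu> > 0")
    case True
    have "(V1 \<longlongrightarrow> V1 \<mu>) (at \<mu>)"
      using DERIV_isCont[OF V1_deriv[OF mu]] by (simp add: isCont_def)
    from order_tendstoD(1)[OF this True] obtain \<delta>2 where \<delta>2: "\<delta>2 > 0"
        "\<And>\<nu>. \<nu> \<noteq> \<mu> \<Longrightarrow> \<bar>\<nu> - \<mu>\<bar> < \<delta>2 \<Longrightarrow> 0 < V1 \<nu>"
      by (auto simp: eventually_at dist_real_def)
    \<comment> \<open>On the left \<open>(V1 \<mu> - P) * (t - \<mu>) \<ge> 0\<close>, even for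
      slope zero, so \<open>log_gap\<close> gives \<open>\<psi> < V\<close> and \<open>J\<close>
      increases up to \<open>\<mu>\<close>.\<close>
    define \<nu> where "\<nu> = \<mu> - min \<delta>1 \<delta>2 / 2"
    have nu: "\<nu> < \<mu>" "\<bar>\<nu> - \<mu>\<bar> < \<delta>1" "\<bar>\<nu> - \<mu>\<bar> < \<delta>2" using \<delta>1(1) \<delta>2(1) by (auto simp: \<nu>_def)
    have near: "t \<in> I \<and> V1 t > 0" if "\<nu> \<le> t" "t < \<mu>" for t
      using \<delta>1(2)[of t] \<delta>2(2)[of t] nu that by auto
    have "J \<nu> < J \<mu>"
    proof (rule DERIV_pos_imp_increasing_open[OF nu(1)])
      fix t assume t: "\<nu> < t" "t < \<mu>"
      then have tI: "t \<in> I" and V1t: "V1 t > 0" using near[of t] by auto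
      have "\<psi> t < V t"
        using t D by (intro log_gap[OF c0 mu tI _ root P]) (auto intro: mult_nonpos_nonpos)
      from J_deriv_factor_sign(1)[OF c0 tI this] J_deriv[OF c0 tI] V1t
      show "\<exists>z. (J has_real_derivative z) (at t) \<and> 0 < z"
        by (intro exI[of _ "(f1 ((V t - b) / a) / a - t / 2) * V1 t"]) simp
    next
      show "continuous_on {\<nu>..\<mu>} J"
      proof (rule contJ, rule subsetI)
        fix t assume "t \<in> {\<nu>..\<mu>}"
        then show "t \<in> I" using near[of t] mu by (cases "t = \<mu>") auto
      qed
    qed
    then show False using \<delta>1(2)[of \<nu>] nu by auto
  next
    case False
    then have V1z: "V1 \<mu> = 0" using V10 by simp
    have "((\<lambda>\<nu>. V \<nu> - \<psi> \<nu>) has_real_derivative V1 \<mu> - P) (at \<mu>)"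
      by (rule DERIV_diff[OF V_deriv[OF mu] P])
    from DERIV_neg_dec_right[OF this] obtain \<delta>2 where \<delta>2: "\<delta>2 > 0"
        "\<forall>h>0. h < \<delta>2 \<longrightarrow> V (\<mu> + h) - \<psi> (\<mu> + h) < V \<mu> - \<psi> \<mu>"
      using V1z P0 by auto
    from DERIV_pos_inc_right[OF V1_deriv[OF mu] V_pos(2)[OF c0 mu]] obtain \<delta>3 where \<delta>3: "\<delta>3 > 0"
        "\<forall>h>0. h < \<delta>3 \<longrightarrow> V1 \<mu> < V1 (\<mu> + h)" by auto
    \<comment> \<open>At a critical point of \<open>V\<close> the descent is to the right:
      \<open>V1\<close> becomes positive as \<open>V2 > 0\<close>, and \<open>V < \<psi>\<close> as
      the slope of \<open>V - \<psi>\<close> is \<open>- P < 0\<close>. To the left both factors of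
      \<open>J'\<close> change sign, so \<open>J\<close> decreases towards \<open>\<mu>\<close> and
      yields nothing.\<close>
    define \<nu> where "\<nu> = \<mu> + min \<delta>1 (min \<delta>2 \<delta>3) / 2"
    have nu: "\<mu> < \<nu>" "\<bar>\<nu> - \<mu>\<bar> < \<delta>1" "\<nu> - \<mu> < \<delta>2" "\<nu> - \<mu> < \<delta>3"
      using \<delta>1(1) \<delta>2(1) \<delta>3(1) by (auto simp: \<nu>_def)
    have near: "t \<in> I" if "\<mu> < t" "t \<le> \<nu>" for t
      using \<delta>1(2)[of t] nu that by auto
    have "J \<nu> < J \<mu>"
    proof (rule DERIV_neg_imp_decreasing_open[OF nu(1)])
      fix t assume t: "\<mu> < t" "t < \<nu>"
      then have tI: "t \<in> I" using near[of t] by auto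
      have "V t < \<psi> t" using \<delta>2(2)[rule_format, of "t - \<mu>"] t nu root by simp
      moreover have "V1 t > 0" using \<delta>3(2)[rule_format, of "t - \<mu>"] t nu V1z by simp
      ultimately show "\<exists>z. (J has_real_derivative z) (at t) \<and> z < 0"
        using J_deriv_factor_sign(2)[OF c0 tI] J_deriv[OF c0 tI]
        by (intro exI[of _ "(f1 ((V t - b) / a) / a - t / 2) * V1 t"]) (simp add: mult_neg_pos)
    next
      show "continuous_on {\<mu>..\<nu>} J"
      proof (rule contJ, rule subsetI)
        fix t assume "t \<in> {\<mu>..\<nu>}"
        then show "t \<in> I" using near[of t] mu by (cases "t = \<mu>") auto
      qed
    qed
    then show False using \<delta>1(2)[of \<nu>] nu by auto
  qed
qed

section \<open>Sufficiency: positive definiteness on the constraint surface\<close>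

lemma form_nonneg:
  assumes mu: "\<mu> \<in> I" and u: "u \<bullet> e p = 0"
  shows "0 \<le> form \<mu> u" "form \<mu> u = 0 \<Longrightarrow> u = 0"
proof -
  have nn: "0 \<le> (d j + \<mu>) * (u \<bullet> e j)\<^sup>2" for j
    using shift_pos[OF mu, of j] u by (cases "j = p") auto
  then show "0 \<le> form \<mu> u" unfolding shifted_form by (intro sum_nonneg)
  assume "form \<mu> u = 0"
  then have "\<forall>j\<in>UNIV. (d j + \<mu>) * (u \<bullet> e j)\<^sup>2 = 0"
    unfolding shifted_form using nn by (subst (asm) sum_nonneg_eq_0_iff) auto
  then show "u = 0" using shift_nonzero[OF mu] by (intro basis_eqI) auto
qed

text \<open>Reverse Cauchy-Schwarz: the form has signature \<open>(1, n - 1)\<close> and is negative at \<open>w\<close>, hence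
  positive on the form-orthogonal complement of \<open>w\<close>, which is the orthogonal complement of \<open>x\<close>.\<close>
lemma form_pos_orthogonal:
  assumes mu: "\<mu> \<in> I" and w: "H *v w + \<mu> *\<^sub>R w = x" "x \<bullet> w < 0"
    and f: "x \<bullet> f = 0" "f \<noteq> 0"
  shows "form \<mu> f > 0"
proof -
  have fw: "form \<mu> w = x \<bullet> w" using form_add[OF w(1), of 0 1] by simp
  have wp: "w \<bullet> e p \<noteq> 0" using form_nonneg(1)[OF mu, of w] fw w(2) by auto
  define t where "t = - (f \<bullet> e p) / (w \<bullet> e p)"
  define h where "h = f + t *\<^sub>R w"
  have hp: "h \<bullet> e p = 0" using wp by (simp add: h_def t_def inner_add_left inner_diff_left)
  have fh: "form \<mu> f = form \<mu> h - t\<^sup>2 * (x \<bullet> w)" unfolding h_def form_add[OF w(1)] by (simp add: f)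
  show ?thesis
  proof (cases "t = 0")
    case True
    then have "h = f" by (simp add: h_def)
    then show ?thesis using form_nonneg[OF mu hp] f(2) by fastforce
  next
    case False
    then have "t\<^sup>2 * (x \<bullet> w) < 0" using w(2) by (intro mult_pos_neg) auto
    then show ?thesis using form_nonneg(1)[OF mu hp] fh by linarith
  qed
qed

text \<open>Split \<open>u = f + t w\<close> with \<open>f\<close> orthogonal to \<open>x\<close>.
  The form has no cross term, is positive at \<open>f\<close>, and together with the rank-one term
  contributes a product of two negative numbers along \<open>w\<close>.\<close>

lemma form_rank_one_pos:
  assumes mu: "\<mu> \<in> I" and w: "H *v w + \<mu> *\<^sub>R w = x"
    and \<kappa>: "\<kappa> > 0" "1 + \<kappa> * (x \<bullet> w) < 0" and u: "u \<noteq> 0"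
  shows "form \<mu> u + \<kappa> * (x \<bullet> u)\<^sup>2 > 0"
proof -
  have neg: "x \<bullet> w < 0" using \<kappa> by (smt (verit) mult_nonneg_nonneg)
  define t where "t = (x \<bullet> u) / (x \<bullet> w)"
  define f where "f = u - t *\<^sub>R w"
  have xu: "x \<bullet> u = t * (x \<bullet> w)" using neg by (simp add: t_def)
  have xf: "x \<bullet> f = 0" using xu by (simp add: f_def inner_diff_right)
  have "u = f + t *\<^sub>R w" by (simp add: f_def)
  then have "form \<mu> u = form \<mu> f + t\<^sup>2 * (x \<bullet> w)" using form_add[OF w, of f t] xf by simp
  then have eq: "form \<mu> u + \<kappa> * (x \<bullet> u)\<^sup>2 = form \<mu> f + t\<^sup>2 * ((x \<bullet> w) * (1 + \<kappa> * (x \<bullet> w)))"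
    by (simp add: xu power2_eq_square algebra_simps)
  have pos: "(x \<bullet> w) * (1 + \<kappa> * (x \<bullet> w)) > 0" using neg \<kappa>(2) by (rule mult_neg_neg)
  show ?thesis
  proof (cases "f = 0")
    case True
    then have "t \<noteq> 0" using u by (auto simp: f_def)
    then have "t\<^sup>2 * ((x \<bullet> w) * (1 + \<kappa> * (x \<bullet> w))) > 0" by (intro mult_pos_pos[OF _ pos]) auto
    then show ?thesis unfolding eq by (simp add: True)
  next
    case False
    have "t\<^sup>2 * ((x \<bullet> w) * (1 + \<kappa> * (x \<bullet> w))) \<ge> 0" by (intro mult_nonneg_nonneg[OF _ less_imp_le[OF pos]]) auto
    then show ?thesis unfolding eq using form_pos_orthogonal[OF mu w neg xf False] by linarith
  qed
qed

text \<open>Compactness of the sphere makes positivity uniform; the constant \<open>\<sigma>\<close>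
  later absorbs a third-order term.\<close>

lemma form_coercive:
  assumes "\<And>u. u \<noteq> 0 \<Longrightarrow> form \<mu> u + \<kappa> * (x \<bullet> u)\<^sup>2 > 0"
  obtains \<sigma> where "\<sigma> > 0" "\<And>u. \<sigma> * (u \<bullet> u) \<le> form \<mu> u + \<kappa> * (x \<bullet> u)\<^sup>2"
proof -
  define F where "F u = form \<mu> u + \<kappa> * (x \<bullet> u)\<^sup>2" for u
  have "continuous_on (sphere 0 1) F"
    unfolding F_def by (intro continuous_intros linear_continuous_on) auto
  moreover have "sphere (0 :: real^'n) 1 \<noteq> {}" by simp
  ultimately obtain z where z: "z \<in> sphere 0 1" "\<And>u. u \<in> sphere 0 1 \<Longrightarrow> F z \<le> F u"
    using continuous_attains_inf[OF compact_sphere] by blast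
  have "F z > 0" unfolding F_def by (rule assms) (use z(1) in auto)
  moreover have "F z * (u \<bullet> u) \<le> F u" for u
  proof (cases "u = 0")
    case True
    then show ?thesis by (simp add: F_def)
  next
    case False
    define n where "n = norm u"
    have n: "n > 0" using False by (simp add: n_def)
    define v where "v = (1 / n) *\<^sub>R u"
    have u: "u = n *\<^sub>R v" using n by (simp add: v_def)
    have "v \<in> sphere 0 1" using n by (simp add: v_def n_def)
    then have "F z * n\<^sup>2 \<le> F v * n\<^sup>2" by (intro mult_right_mono z(2)) auto
    also have "F v * n\<^sup>2 = F (n *\<^sub>R v)"
      by (simp add: F_def matrix_vector_mult_scaleR power2_eq_square algebra_simps)
    finally show ?thesis unfolding u[symmetric] by (simp add: n_def dot_square_norm)
  qed
  ultimately show ?thesis using that unfolding F_def by blast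
qed

text \<open>Near \<open>y\<close> the difference quotient of \<open>f1\<close> exceeds
  \<open>k\<close>, so \<open>E\<close>, which is \<open>f0\<close> minus its linear increment and
  the quadratic, has a derivative with the sign of \<open>z - y\<close>. The gap
  \<open>k < f2 y\<close> swallows the Taylor remainder.\<close>

lemma quadratic_lower_bound:
  assumes y: "a * y + b > 0" and k: "k < f2 y"
  shows "\<exists>\<delta>>0. \<forall>z. \<bar>z - y\<bar> < \<delta> \<longrightarrow>
    a * z + b > 0 \<and> f0 y + f1 y * (z - y) + k / 2 * (z - y)\<^sup>2 \<le> f0 z"
proof -
  have "((\<lambda>z. (f1 z - f1 y) / (z - y)) \<longlongrightarrow> f2 y) (at y)"
    using f2[OF y] by (simp add: has_field_derivative_iff)
  from order_tendstoD(1)[OF this k]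
  have "\<forall>\<^sub>F z in at y. k < (f1 z - f1 y) / (z - y)" .
  moreover have "\<forall>\<^sub>F z in at y. z \<in> {z. a * z + b > 0}"
    by (rule eventually_at_in_open') (use y in \<open>auto intro!: open_Collect_less continuous_intros\<close>)
  ultimately have "\<forall>\<^sub>F z in at y. k < (f1 z - f1 y) / (z - y) \<and> a * z + b > 0"
    by eventually_elim simp
  then obtain \<delta> where \<delta>: "\<delta> > 0"
      "\<And>z. z \<noteq> y \<Longrightarrow> \<bar>z - y\<bar> < \<delta> \<Longrightarrow> k < (f1 z - f1 y) / (z - y) \<and> a * z + b > 0"
    by (auto simp: eventually_at dist_real_def)
  define E where "E z = f0 z - f1 y * (z - y) - k / 2 * (z - y)\<^sup>2" for z
  have S: "a * z + b > 0" if "\<bar>z - y\<bar> < \<delta>" for z using \<delta>(2)[of z] that y by (cases "z = y") auto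
  have dE: "(E has_real_derivative f1 z - f1 y - k * (z - y)) (at z)" if "\<bar>z - y\<bar> < \<delta>" for z
    unfolding E_def using f1[OF S[OF that]]
    by (auto intro!: derivative_eq_intros simp: field_simps)
  have "E y \<le> E z" if z: "\<bar>z - y\<bar> < \<delta>" for z
  proof (cases "y \<le> z")
    case True
    show ?thesis
    proof (rule DERIV_nonneg_imp_nondecreasing[OF True])
      fix t assume t: "y \<le> t" "t \<le> z"
      then have td: "\<bar>t - y\<bar> < \<delta>" using z by simp
      have "f1 t - f1 y - k * (t - y) \<ge> 0"
      proof (cases "t = y")
        case False
        then show ?thesis using \<delta>(2)[OF False td] t by (simp add: pos_less_divide_eq)
      qed simp
      then show "\<exists>s. (E has_real_derivative s) (at t) \<and> 0 \<le> s" using dE[OF td] by blast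
    qed
  next
    case False
    then have zy: "z \<le> y" by simp
    show ?thesis
    proof (rule DERIV_nonpos_imp_nonincreasing[OF zy])
      fix t assume t: "z \<le> t" "t \<le> y"
      then have td: "\<bar>t - y\<bar> < \<delta>" using z by simp
      have "f1 t - f1 y - k * (t - y) \<le> 0"
      proof (cases "t = y")
        case False
        then show ?thesis using \<delta>(2)[OF False td] t by (simp add: neg_less_divide_eq)
      qed simp
      then show "\<exists>s. (E has_real_derivative s) (at t) \<and> s \<le> 0" using dE[OF td] by blast
    qed
  qed
  then show ?thesis using \<delta>(1) S by (force simp: E_def)
qed

text \<open>With \<open>a R = 2 A + B\<close> the multiplier terms cancel, and the objective grows
  by at least half of \<open>\<sigma> B + k (4 A B + B^2) / a^2\<close>. Only \<open>A B\<close> can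
  be negative. As \<open>\<bar>A\<bar> \<le> norm x * norm t\<close>, the radius imposed on
  \<open>t\<close> lets \<open>\<sigma> B\<close> dominate it; the summand 1 keeps the denominator
  positive.\<close>

lemma surface_local_bound:
  assumes y: "a * y + b > 0" and act: "x \<bullet> x = a * y + b"
    and kkt: "H *v x + \<mu> *\<^sub>R x + c = 0" "f1 y = a * \<mu> / 2"
    and k: "k > 0" and \<sigma>: "\<And>u. \<sigma> * (u \<bullet> u) \<le> form \<mu> u + 4 * k / a\<^sup>2 * (x \<bullet> u)\<^sup>2"
    and t: "norm t \<le> \<sigma> * a\<^sup>2 / (4 * k * (norm x + 1))"
    and r: "a * (r - y) = 2 * (x \<bullet> t) + t \<bullet> t"
    and low: "f0 y + f1 y * (r - y) + k / 2 * (r - y)\<^sup>2 \<le> f0 r"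
  shows "obj (x, y) \<le> obj (x + t, r)"
proof -
  define R A B where "R = r - y" and "A = x \<bullet> t" and "B = t \<bullet> t"
  have B0: "B \<ge> 0" by (simp add: B_def)
  have xt: "(x + t) \<bullet> (x + t) - x \<bullet> x = a * R"
    unfolding R_def r by (simp add: inner_add inner_commute)
  have "obj (x + t, r) - obj (x, y) = 1 / 2 * form \<mu> t - \<mu> / 2 * (a * R) + (f0 r - f0 y)"
    unfolding Q_objective_pair stationary_diff[OF kkt(1)] xt by simp
  moreover have "f0 r - f0 y \<ge> \<mu> / 2 * (a * R) + k / 2 * R\<^sup>2"
    using low unfolding R_def[symmetric] kkt(2) by (simp add: algebra_simps)
  moreover have "\<sigma> * B - 4 * k / a\<^sup>2 * A\<^sup>2 \<le> form \<mu> t" using \<sigma>[of t] by (simp add: A_def B_def)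
  moreover have "4 * k / a\<^sup>2 * A\<^sup>2 - \<sigma> * B \<le> k * R\<^sup>2"
  proof -
    have "norm x + 1 > 0" by (simp add: add_nonneg_pos)
    then have "4 * k * (norm x + 1) > 0" using k by simp
    then have "norm t * (4 * k * (norm x + 1)) \<le> \<sigma> * a\<^sup>2"
      using t by (simp only: pos_le_divide_eq)
    moreover have "norm t * (4 * k * norm x) \<le> norm t * (4 * k * (norm x + 1))"
      using k by (intro mult_left_mono) auto
    ultimately have "4 * k * (norm x * norm t) \<le> \<sigma> * a\<^sup>2" by (simp add: mult_ac)
    moreover have "4 * k * (- A) \<le> 4 * k * (norm x * norm t)"
      using k Cauchy_Schwarz_ineq2[of x t] by (intro mult_left_mono) (auto simp: A_def)
    ultimately have "4 * k * (- A) \<le> \<sigma> * a\<^sup>2" by (rule order_trans[rotated])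
    then have "4 * k * (- A) * B \<le> \<sigma> * a\<^sup>2 * B" using B0 by (rule mult_right_mono)
    moreover have "k * (2 * A + B)\<^sup>2 = 4 * k * A\<^sup>2 + 4 * k * A * B + k * B\<^sup>2"
      by (simp add: power2_eq_square algebra_simps)
    moreover have "k * B\<^sup>2 \<ge> 0" using k by simp
    ultimately have "4 * k * A\<^sup>2 - \<sigma> * a\<^sup>2 * B \<le> k * (2 * A + B)\<^sup>2" by simp
    also have "\<dots> = k * R\<^sup>2 * a\<^sup>2"
      using r unfolding R_def[symmetric] A_def[symmetric] B_def[symmetric]
      by (simp add: power_mult_distrib[symmetric] mult_ac flip: r)
    finally have "(4 * k * A\<^sup>2 - \<sigma> * a\<^sup>2 * B) / a\<^sup>2 \<le> k * R\<^sup>2"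
      using a_pos by (simp add: pos_divide_le_eq)
    then show ?thesis using a_pos by (simp add: diff_divide_distrib)
  qed
  ultimately have "obj (x + t, r) - obj (x, y) \<ge> 0" by argo
  then show ?thesis by simp
qed

lemma sufficient_local_minimizer:
  assumes y: "a * y + b > 0" and act: "x \<bullet> x = a * y + b"
    and kkt: "H *v x + \<mu> *\<^sub>R x + c = 0" "f1 y = a * \<mu> / 2" and mu: "\<mu> \<in> I"
    and D: "V1 \<mu> - a\<^sup>2 / (2 * f2 y) > 0"
  shows "local_minimizer obj feas (x, y)"
proof -
  obtain w where w: "H *v w + \<mu> *\<^sub>R w = x" "x \<bullet> w = - V1 \<mu> / 2"
    using preimage_of_stationary[OF kkt(1) mu] .
  have f2p: "f2 y > 0" using f2_ge[OF y] m_pos by simp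
  have "a\<^sup>2 / (2 * f2 y) > 0" using f2p a_pos by simp
  then have V1p: "V1 \<mu> > 0" using D by simp
  have "a\<^sup>2 / (2 * V1 \<mu>) < f2 y"
    using D f2p V1p by (simp add: field_simps)
  \<comment> \<open>The lower bound on \<open>k\<close> makes the rank-one perturbation positive
    definite, the upper bound makes the quadratic estimate of \<open>f0\<close> available.\<close>
  then obtain k where k: "a\<^sup>2 / (2 * V1 \<mu>) < k" "k < f2 y" using dense by blast
  have "a\<^sup>2 / (2 * V1 \<mu>) > 0" using a_pos V1p by simp
  then have k0: "k > 0" using k(1) by linarith
  have "1 + 4 * k / a\<^sup>2 * (x \<bullet> w) < 0"
    using k(1) a_pos V1p by (simp add: w(2) field_simps)
  then have "\<And>u. u \<noteq> 0 \<Longrightarrow> form \<mu> u + 4 * k / a\<^sup>2 * (x \<bullet> u)\<^sup>2 > 0"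
    using k0 a_pos by (intro form_rank_one_pos[OF mu w(1)]) auto
  then obtain \<sigma> where \<sigma>: "\<sigma> > 0" "\<And>u. \<sigma> * (u \<bullet> u) \<le> form \<mu> u + 4 * k / a\<^sup>2 * (x \<bullet> u)\<^sup>2"
    using form_coercive by blast
  obtain \<delta> where \<delta>: "\<delta> > 0"
    "\<And>z. \<bar>z - y\<bar> < \<delta> \<Longrightarrow> a * z + b > 0 \<and> f0 y + f1 y * (z - y) + k / 2 * (z - y)\<^sup>2 \<le> f0 z"
    using quadratic_lower_bound[OF y k(2)] by blast
  \<comment> \<open>A positive multiplier makes \<open>f0\<close> increasing near \<open>y\<close>,
    so lowering a nearby feasible point to the surface does not increase the objective.\<close>
  have f1y: "f1 y > 0" unfolding kkt(2) using mu a_pos by simp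
  have "isCont f1 y" using f2[OF y] by (rule DERIV_isCont)
  then have "\<forall>\<^sub>F z in nhds y. f1 z > 0"
    using order_tendstoD(1)[OF _ f1y] by (simp add: continuous_within tendsto_at_iff_tendsto_nhds)
  then obtain \<delta>1 where \<delta>1: "\<delta>1 > 0" "\<And>z. \<bar>z - y\<bar> < \<delta>1 \<Longrightarrow> f1 z > 0"
    by (auto simp: eventually_nhds_metric dist_real_def)
  define \<rho> where "\<rho> = \<sigma> * a\<^sup>2 / (4 * k * (norm x + 1))"
  have \<rho>: "\<rho> > 0" using \<sigma>(1) a_pos k0 by (auto simp: \<rho>_def intro!: divide_pos_pos mult_pos_pos add_nonneg_pos)
  define s where "s z = (z \<bullet> z - b) / a" for z :: "real^'n"
  have "((\<lambda>z. s z) \<longlongrightarrow> s x) (nhds x)"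
    unfolding s_def using a_pos by (intro tendsto_intros filterlim_ident) auto
  moreover have "s x = y" using act a_pos by (simp add: s_def)
  ultimately have "(s \<longlongrightarrow> y) (nhds x)" by simp
  then have "\<forall>\<^sub>F z in nhds x. dist (s z) y < min \<delta> \<delta>1"
    by (rule tendstoD) (use \<delta>(1) \<delta>1(1) in simp)
  then obtain \<eta> where \<eta>: "\<eta> > 0" "\<And>z. dist z x < \<eta> \<Longrightarrow> \<bar>s z - y\<bar> < \<delta> \<and> \<bar>s z - y\<bar> < \<delta>1"
    by (auto simp: eventually_nhds_metric dist_real_def)
  show ?thesis
    unfolding local_minimizer_def
  proof (intro conjI exI[of _ "min \<eta> \<rho>"] ballI impI)
    show "(x, y) \<in> feas" using act by (simp add: Q_feasible_iff)
    show "min \<eta> \<rho> > 0" using \<eta>(1) \<rho> by simp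
    fix v assume v: "v \<in> feas" "dist v (x, y) < min \<eta> \<rho>"
    obtain z y' where vz: "v = (z, y')" by (cases v)
    have fe: "z \<bullet> z \<le> a * y' + b" using v(1) by (simp add: vz Q_feasible_iff)
    have dz: "dist z x < min \<eta> \<rho>"
      using dist_fst_le[of v "(x, y)"] v(2) by (simp add: vz)
    have near: "\<bar>s z - y\<bar> < \<delta>" "\<bar>s z - y\<bar> < \<delta>1" using \<eta>(2)[of z] dz by auto
    define t where "t = z - x"
    have zt: "z = x + t" by (simp add: t_def)
    have as: "a * s z = z \<bullet> z - b" using a_pos by (simp add: s_def)
    have "obj (x, y) \<le> obj (x + t, s z)"
    proof (rule surface_local_bound[OF y act kkt k0 \<sigma>(2)])
      show "norm t \<le> \<sigma> * a\<^sup>2 / (4 * k * (norm x + 1))"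
        using dz by (simp add: t_def dist_norm \<rho>_def[symmetric])
      show "a * (s z - y) = 2 * (x \<bullet> t) + t \<bullet> t"
        using act by (simp add: right_diff_distrib as) (simp add: zt inner_add inner_commute)
      show "f0 y + f1 y * (s z - y) + k / 2 * (s z - y)\<^sup>2 \<le> f0 (s z)"
        using \<delta>(2)[OF near(1)] by simp
    qed
    also have "obj (x + t, s z) \<le> obj (x + t, y')"
    proof -
      have sS: "a * s z + b > 0" using \<delta>(2)[OF near(1)] by simp
      have "a * s z \<le> a * y'" using fe as by simp
      then have "s z \<le> y'" using a_pos by simp
      moreover have "a * y' + b \<ge> 0" using fe by (meson inner_ge_zero order_trans)
      then have "f0 (s z) + f1 (s z) * (y' - s z) \<le> f0 y'" by (rule tangent[OF sS])
      ultimately have "f0 (s z) \<le> f0 y'"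
        using \<delta>1(2)[OF near(2)] by (smt (verit) mult_nonneg_nonneg)
      then show ?thesis by (simp add: Q_objective_pair)
    qed
    finally show "obj (x, y) \<le> obj v" by (simp add: vz zt)
  qed
qed

text \<open>Reflecting \<open>x\<close> in the hyperplane orthogonal to \<open>e p\<close> stays on
  the sphere and changes the objective by
  \<open>2 (x \<bullet> e p)^2 (d p + \<mu>) < 0\<close>.\<close>

lemma stationary_not_global:
  assumes y: "a * y + b > 0" and act: "x \<bullet> x = a * y + b"
    and kkt: "H *v x + \<mu> *\<^sub>R x + c = 0" "f1 y = a * \<mu> / 2" and mu: "\<mu> \<in> I"
    and loc: "local_minimizer obj feas (x, y)"
  shows "\<not> global_minimizer obj feas (x, y)"
proof
  assume glob: "global_minimizer obj feas (x, y)"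
  have xp: "x \<bullet> e p \<noteq> 0"
    using not_local_if_orthogonal[OF y act kkt] mu loc by force
  define t where "t = (- 2 * (x \<bullet> e p)) *\<^sub>R e p"
  have sph: "(x + t) \<bullet> (x + t) = x \<bullet> x"
    by (simp add: t_def inner_add inner_diff inner_commute norm_e)
  have "form \<mu> t = 4 * (x \<bullet> e p)\<^sup>2 * (d p + \<mu>)"
    by (simp add: t_def matrix_vector_mult_scaleR form_neg norm_e power2_eq_square algebra_simps
        linear_neg)
  also have "\<dots> < 0" using xp shift_neg[OF mu] by (intro mult_pos_neg) auto
  finally have "form \<mu> t < 0" .
  moreover have "obj (x + t, y) - obj (x, y) = 1 / 2 * form \<mu> t"
    unfolding Q_objective_pair stationary_diff[OF kkt(1)] sph by simp
  moreover have "obj (x, y) \<le> obj (x + t, y)"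
    using glob act by (auto simp: global_minimizer_def Q_feasible_iff sph)
  ultimately show False by simp
qed

section \<open>Characterization and uniqueness\<close>

lemma phi_root_deriv:
  assumes y: "a * y + b > 0" "f1 y = a * \<mu> / 2" and mu: "\<mu> \<in> I"
  shows "phi H c a b f0 \<mu> = V \<mu> - (a * y + b)"
    and "(phi H c a b f0 has_real_derivative V1 \<mu> - a\<^sup>2 / (2 * f2 y)) (at \<mu>)"
proof -
  show "phi H c a b f0 \<mu> = V \<mu> - (a * y + b)"
    by (simp add: phi_def varphi_eq[OF mu] psi_eq[OF y])
  have "((\<lambda>\<nu>. V \<nu> - \<psi> \<nu>) has_real_derivative V1 \<mu> - a\<^sup>2 / (2 * f2 y)) (at \<mu>)"
    by (intro DERIV_diff V_deriv psi_deriv y mu)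
  then show "(phi H c a b f0 has_real_derivative V1 \<mu> - a\<^sup>2 / (2 * f2 y)) (at \<mu>)"
    by (rule has_field_derivative_transform_within_open[OF _ open_greaterThanLessThan mu])
       (simp add: phi_def varphi_eq)
qed

lemma local_nonglobal_iff:
  "local_nonglobal_minimizer obj feas (x, y) \<longleftrightarrow>
    (\<exists>\<mu>\<in>I. H *v x + \<mu> *\<^sub>R x + c = 0 \<and> a * y + b > 0 \<and> f1 y = a * \<mu> / 2 \<and>
      phi H c a b f0 \<mu> = 0 \<and> (\<exists>D>0. (phi H c a b f0 has_real_derivative D) (at \<mu>)))"
  (is "_ \<longleftrightarrow> ?R")
proof
  assume lng: "local_nonglobal_minimizer obj feas (x, y)"
  then have loc: "local_minimizer obj feas (x, y)" by (simp add: local_nonglobal_minimizer_def)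
  obtain \<mu> where y: "a * y + b > 0" and act: "x \<bullet> x = a * y + b"
    and kkt: "H *v x + \<mu> *\<^sub>R x + c = 0" "f1 y = a * \<mu> / 2" and m1: "max (- d q) 0 < \<mu>" "\<mu> < - d p"
    using local_nonglobal_multiplier[OF lng] .
  have mu: "\<mu> \<in> I" using m1 by simp
  have "x = X \<mu>" using stationary_X[OF mu] kkt(1) by blast
  then have "phi H c a b f0 \<mu> = 0"
    using phi_root_deriv(1)[OF y kkt(2) mu] act by (simp add: X_norm)
  then show ?R
    using mu y kkt phi_root_deriv(2)[OF y kkt(2) mu]
      local_minimizer_derivative_pos[OF loc y act kkt mu] by blast
next
  assume ?R
  then obtain \<mu> D where mu: "\<mu> \<in> I" and kkt: "H *v x + \<mu> *\<^sub>R x + c = 0" "f1 y = a * \<mu> / 2"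
    and y: "a * y + b > 0" and root: "phi H c a b f0 \<mu> = 0"
    and D: "D > 0" "(phi H c a b f0 has_real_derivative D) (at \<mu>)" by blast
  have "x = X \<mu>" using stationary_X[OF mu] kkt(1) by blast
  then have act: "x \<bullet> x = a * y + b"
    using phi_root_deriv(1)[OF y kkt(2) mu] root by (simp add: X_norm)
  have "V1 \<mu> - a\<^sup>2 / (2 * f2 y) > 0"
    using DERIV_unique[OF phi_root_deriv(2)[OF y kkt(2) mu] D(2)] D(1) by simp
  from sufficient_local_minimizer[OF y act kkt mu this]
  show "local_nonglobal_minimizer obj feas (x, y)"
    using stationary_not_global[OF y act kkt mu] by (simp add: local_nonglobal_minimizer_def)
qed

text \<open>A root with positive slope keeps \<open>V\<close> above \<open>\<psi>\<close> at every
  larger multiplier in \<open>I\<close>, so no second root lies to its right. Applied both ways this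
  equates the multipliers, and the multiplier determines \<open>x\<close> and
  \<open>y\<close>.\<close>

lemma local_nonglobal_unique:
  assumes l1: "local_nonglobal_minimizer obj feas (x, y)"
    and l2: "local_nonglobal_minimizer obj feas (x', y')"
  shows "(x, y) = (x', y')"
proof -
  have roots: "\<mu> = \<nu> \<or> \<nu> < \<mu>"
    if 1: "local_minimizer obj feas (x, y)" "a * y + b > 0" "x \<bullet> x = a * y + b"
      "H *v x + \<mu> *\<^sub>R x + c = 0" "f1 y = a * \<mu> / 2" "\<mu> \<in> I"
    and 2: "a * y' + b > 0" "x' \<bullet> x' = a * y' + b"
      "H *v x' + \<nu> *\<^sub>R x' + c = 0" "f1 y' = a * \<nu> / 2" "\<nu> \<in> I"
    for x y \<mu> x' y' \<nu>
  proof (rule ccontr)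
    assume "\<not> ?thesis"
    then have less: "\<mu> < \<nu>" by auto
    have "\<psi> \<nu> < V \<nu>"
    proof (rule log_gap[OF root_of_stationary(2)[OF 1(2-6)] 1(6) 2(5) _
          root_of_stationary(1)[OF 1(2-6)] psi_deriv[OF 1(6,2,5)]])
      show "0 \<le> (V1 \<mu> - a\<^sup>2 / (2 * f2 y)) * (\<nu> - \<mu>)"
        using local_minimizer_derivative_pos[OF 1] less by (intro mult_nonneg_nonneg) auto
    qed (use less in simp)
    then show False using root_of_stationary(1)[OF 2] by simp
  qed
  have loc1: "local_minimizer obj feas (x, y)" and loc2: "local_minimizer obj feas (x', y')"
    using l1 l2 by (simp_all add: local_nonglobal_minimizer_def)
  obtain \<mu> where 1: "a * y + b > 0" "x \<bullet> x = a * y + b" "H *v x + \<mu> *\<^sub>R x + c = 0"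
    "f1 y = a * \<mu> / 2" "max (- d q) 0 < \<mu>" "\<mu> < - d p"
    using local_nonglobal_multiplier[OF l1] .
  obtain \<nu> where 2: "a * y' + b > 0" "x' \<bullet> x' = a * y' + b" "H *v x' + \<nu> *\<^sub>R x' + c = 0"
    "f1 y' = a * \<nu> / 2" "max (- d q) 0 < \<nu>" "\<nu> < - d p"
    using local_nonglobal_multiplier[OF l2] .
  have mu: "\<mu> \<in> I" and nu: "\<nu> \<in> I" using 1 2 by auto
  have eq: "\<mu> = \<nu>"
    using roots[OF loc1 1(1-4) mu 2(1-4) nu] roots[OF loc2 2(1-4) nu 1(1-4) mu] by auto
  have "x = x'" using stationary_X[OF mu] 1(3) 2(3) eq by metis
  moreover have "y = y'" using inj_f1[OF 1(1) 2(1)] 1(4) 2(4) eq by simp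
  ultimately show ?thesis by simp
qed

end

section \<open>From the hypotheses to the locale\<close>

lemma strongly_convex_derivative_monotone:
  fixes f f' :: "real \<Rightarrow> real"
  assumes S: "convex S" "open S"
    and f': "\<And>y. y \<in> S \<Longrightarrow> (f has_real_derivative f' y) (at y)"
    and ineq: "\<And>x y t. x \<in> S \<Longrightarrow> y \<in> S \<Longrightarrow> 0 \<le> t \<Longrightarrow> t \<le> 1 \<Longrightarrow>
      f ((1 - t) *\<^sub>R x + t *\<^sub>R y) \<le> (1 - t) * f x + t * f y - m / 2 * t * (1 - t) * (norm (x - y))\<^sup>2"
    and yz: "y \<in> S" "z \<in> S"
  shows "m * (y - z)\<^sup>2 \<le> (f' y - f' z) * (y - z)"
proof -
  \<comment> \<open>Strong convexity of \<open>f\<close> is convexity of \<open>g\<close>; the sum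
    of its tangent inequalities at \<open>y\<close> and \<open>z\<close> is the claim.\<close>
  define g where "g y = f y - m / 2 * y\<^sup>2" for y
  have g: "convex_on S g"
  proof (rule convex_onI)
    fix t x y :: real assume t: "0 < t" "t < 1" and xy: "x \<in> S" "y \<in> S"
    define w where "w = (1 - t) *\<^sub>R x + t *\<^sub>R y"
    define K where "K = m / 2 * t * (1 - t) * (x - y)\<^sup>2"
    have "m / 2 * w\<^sup>2 = (1 - t) * (m / 2 * x\<^sup>2) + t * (m / 2 * y\<^sup>2) - K"
      by (simp add: w_def K_def power2_eq_square field_simps)
    moreover have "f w \<le> (1 - t) * f x + t * f y - K"
      using ineq[OF xy, of t] t by (simp add: w_def K_def)
    ultimately have "g w \<le> (1 - t) * g x + t * g y"
      unfolding g_def right_diff_distrib by linarith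
    then show "g ((1 - t) *\<^sub>R x + t *\<^sub>R y) \<le> (1 - t) * g x + t * g y" by (simp only: w_def)
  qed (rule S)
  have tan: "(f' u - m * u) * (v - u) \<le> g v - g u" if "u \<in> S" "v \<in> S" for u v
  proof (rule convex_on_imp_above_tangent[OF g convex_connected[OF S(1)]])
    show "u \<in> interior S" using that S(2) by (simp add: interior_open)
    show "(g has_real_derivative f' u - m * u) (at u within S)"
      unfolding g_def
      by (rule has_field_derivative_at_within)
         (use f'[OF that(1)] in \<open>auto intro!: derivative_eq_intros\<close>)
  qed (rule that)
  from tan[OF yz] tan[OF yz(2,1)] show ?thesis
    by (simp add: power2_eq_square algebra_simps)
qed

lemma k_times_cont_diff_on_deriv:
  assumes f: "k_times_cont_diff_on k f S" "open S" and i: "i < k" and y: "y \<in> S"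
  shows "((deriv ^^ i) f has_real_derivative (deriv ^^ Suc i) f y) (at y)"
proof -
  have "(deriv ^^ i) f differentiable_on S" using f(1) i by (simp add: k_times_cont_diff_on_def)
  then have "(deriv ^^ i) f differentiable at y"
    using f(2) y by (simp add: differentiable_on_eq_differentiable_at)
  then show ?thesis by (simp add: DERIV_deriv_iff_real_differentiable)
qed

lemma log_concave_trust_regionI:
  fixes H :: "real^'n^'n"
  assumes n: "CARD('n) \<ge> 2"
    and symm: "transpose H = H"
    and not_psd: "\<not> positive_semidefinite H"
    and a_pos: "a > 0"
    and f0_convex: "convex_on {y. a * y + b \<ge> 0} f0"
    and eigs: "ordered_eigenvalues H lam"
    and f0_C2: "k_times_cont_diff_on k f0 (Q_S a b)" "k \<ge> 2"
    and f0_strong: "strongly_convex_on (Q_S a b) f0"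
    and psi_defined: "\<forall>\<mu>\<in>{max (- lam 2) 0<..<- lam 1}. \<mu> * a / 2 \<in> deriv f0 ` Q_S a b"
    and psi_log_concave: "log_concave_on {max (- lam 2) 0<..<- lam 1} (psi a b f0)"
  shows "\<exists>e d m p q. log_concave_trust_region H e d a b m f0 (deriv f0) (deriv (deriv f0)) p q \<and>
    d p = lam 1 \<and> d q = lam 2"
proof -
  obtain e :: "'n \<Rightarrow> real^'n" and d where
    orth: "\<And>i j. e i \<bullet> e j = (if i = j then 1 else 0)" and eig: "\<And>i. H *v e i = d i *\<^sub>R e i"
    using spectral_theorem[OF symm] by blast
  interpret eigenbasis H e d by unfold_locales (rule symm orth eig)+
  obtain \<sigma> where \<sigma>: "bij_betw \<sigma> {1..CARD('n)} UNIV" "\<forall>i\<in>{1..CARD('n)}. lam i = d (\<sigma> i)"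
    using ordered_eigenvalues_diagonal[OF orth eig eigs] by blast
  \<comment> \<open>\<open>\<sigma>\<close> lists the eigenvectors in the order of
    \<open>lam\<close>. Taking two positions rather than two values respects multiplicity.\<close>
  define p q where "p = \<sigma> 1" and "q = \<sigma> 2"
  have dp: "d p = lam 1" and dq: "d q = lam 2" using \<sigma>(2) n by (simp_all add: p_def q_def)
  have pq: "p \<noteq> q" using inj_on_eq_iff[OF bij_betw_imp_inj_on[OF \<sigma>(1)], of 1 2] n by (simp add: p_def q_def)
  have mono: "lam i \<le> lam j" if "i \<in> {1..CARD('n)}" "j \<in> {1..CARD('n)}" "i \<le> j" for i j
    using eigs that by (auto simp: ordered_eigenvalues_def mono_on_def)
  have least: "d p \<le> d j \<and> (j \<noteq> p \<longrightarrow> d q \<le> d j)" for j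
  proof -
    have "j \<in> \<sigma> ` {1..CARD('n)}" using \<sigma>(1) by (simp add: bij_betw_def)
    then obtain i where i: "i \<in> {1..CARD('n)}" "j = \<sigma> i" by blast
    then have dj: "d j = lam i" using \<sigma>(2) by simp
    have "lam 1 \<le> lam i" using i n by (intro mono) auto
    moreover have "lam 2 \<le> lam i" if "j \<noteq> p"
    proof -
      have "i \<noteq> 1" using that i(2) by (auto simp: p_def)
      then show ?thesis using i n by (intro mono) auto
    qed
    ultimately show ?thesis by (simp add: dj dp dq)
  qed
  have dp_neg: "d p < 0"
  proof (rule ccontr)
    assume "\<not> ?thesis"
    then have "\<And>j. d j \<ge> 0" using least by (meson not_less order_trans)
    then have "0 \<le> x \<bullet> (H *v x) + 0 * (x \<bullet> x)" for x
      unfolding shifted_form by (intro sum_nonneg mult_nonneg_nonneg) auto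
    then show False using not_psd by (simp add: positive_semidefinite_def)
  qed
  have S_open: "open (Q_S a b)"
    unfolding Q_S_def by (intro open_Collect_less continuous_intros)
  obtain m where m: "m > 0" and S_conv: "convex (Q_S a b)"
    and ineq: "\<forall>x\<in>Q_S a b. \<forall>y\<in>Q_S a b. \<forall>t\<in>{0..1}.
        f0 ((1 - t) *\<^sub>R x + t *\<^sub>R y)
          \<le> (1 - t) * f0 x + t * f0 y - m / 2 * t * (1 - t) * (norm (x - y))\<^sup>2"
    using f0_strong by (auto simp: strongly_convex_on_def)
  have f1: "(f0 has_real_derivative deriv f0 y) (at y)" if "y \<in> Q_S a b" for y
    using k_times_cont_diff_on_deriv[OF f0_C2(1) S_open _ that, of 0] f0_C2(2) by simp
  have f2: "(deriv f0 has_real_derivative deriv (deriv f0) y) (at y)" if "y \<in> Q_S a b" for y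
    using k_times_cont_diff_on_deriv[OF f0_C2(1) S_open _ that, of 1] f0_C2(2) by simp
  have "log_concave_trust_region H e d a b m f0 (deriv f0) (deriv (deriv f0)) p q"
  proof (unfold_locales)
    fix y z assume "a * y + b > 0" "a * z + b > 0"
    then show "m * (y - z)\<^sup>2 \<le> (deriv f0 y - deriv f0 z) * (y - z)"
      using ineq by (intro strongly_convex_derivative_monotone[OF S_conv S_open f1])
        (auto simp: Q_S_def)
  qed (use pq least dp_neg a_pos m f0_convex f1 f2 psi_defined psi_log_concave
        in \<open>auto simp: Q_S_def dp dq\<close>)
  then show ?thesis using dp dq by blast
qed

theorem theorem7:
  fixes H :: "real^'n^'n" and c :: "real^'n" and a b :: real
    and f0 :: "real \<Rightarrow> real" and lam :: "nat \<Rightarrow> real"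
  assumes n: "CARD('n) \<ge> 2"
    and symm: "transpose H = H"
    and not_psd: "\<not> positive_semidefinite H"
    and a_pos: "a > 0"
    and f0_convex: "convex_on {y. a * y + b \<ge> 0} f0"
    and eigs: "ordered_eigenvalues H lam"
    and f0_C3: "k_times_cont_diff_on 3 f0 (Q_S a b)"
    and f0_strong: "strongly_convex_on (Q_S a b) f0"
    and psi_defined: "\<forall>\<mu>\<in>{max (- lam 2) 0<..<- lam 1}. \<mu> * a / 2 \<in> deriv f0 ` Q_S a b"
    and psi_log_concave: "log_concave_on {max (- lam 2) 0<..<- lam 1} (psi a b f0)"
  shows "(\<exists>\<^sub>\<le>\<^sub>1 p. local_nonglobal_minimizer (Q_objective H c f0) (Q_feasible a b) p) \<and>
    (\<forall>x y. local_nonglobal_minimizer (Q_objective H c f0) (Q_feasible a b) (x, y) \<longleftrightarrow>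
       (\<exists>\<mu>\<in>{max (- lam 2) 0<..<- lam 1}.
          (H + mat \<mu>) *v x + c = 0 \<and>
          y \<in> Q_S a b \<and> deriv f0 y - a * \<mu> / 2 = 0 \<and>
          phi H c a b f0 \<mu> = 0 \<and>
          (\<exists>D>0. (phi H c a b f0 has_real_derivative D) (at \<mu>))))"
proof -
  obtain e d m p q where "log_concave_trust_region H e d a b m f0 (deriv f0) (deriv (deriv f0)) p q"
    and lam: "d p = lam 1" "d q = lam 2"
    using log_concave_trust_regionI[OF n symm not_psd a_pos f0_convex eigs f0_C3 _ f0_strong
        psi_defined psi_log_concave] by auto
  then interpret log_concave_trust_region H e d c a b m f0 "deriv f0" "deriv (deriv f0)" p q
    by simp
  have "\<exists>\<^sub>\<le>\<^sub>1 p. local_nonglobal_minimizer (Q_objective H c f0) (Q_feasible a b) p"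
    unfolding Uniq_def split_paired_All using local_nonglobal_unique by metis
  moreover have "(H + mat \<mu>) *v x + c = H *v x + \<mu> *\<^sub>R x + c" for \<mu> x
    by (simp add: matrix_vector_mult_add_rdistrib mat_scaleR)
  moreover have "y \<in> Q_S a b \<and> deriv f0 y - a * \<mu> / 2 = 0 \<longleftrightarrow> a * y + b > 0 \<and> deriv f0 y = a * \<mu> / 2"
    for y \<mu> by (auto simp: Q_S_def)
  ultimately show ?thesis
    using local_nonglobal_iff unfolding lam by (simp add: Q_S_def)
qed

end
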